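(* In the semidirect product $\mathcal S$ let $$\widetilde{D_{i,j}}=Z_{i,j}L(\lambda_{\mu_i})^{-1}L(\lambda_{\nu_j}),\qquad i,j=1,\dots,n,$$ and let $\widetilde{D_q(n)}$ be the subalgebra generated by these elements. Then $\widetilde{D_q(n)}$ is isomorphic to $D_{q^{-2}}(n)$.
   Context: Let $q\in\mathbb C^*$, $q^2\ne1$. $M_q(n)$ is the $\mathbb C$-algebra generated by $Z_{i,j}$ ($1\le i,j\le n$) with defining relations $Z_{i,j}Z_{i,k}=qZ_{i,k}Z_{i,j}$ if $j<k$; $Z_{i,j}Z_{k,j}=qZ_{k,j}Z_{i,j}$ if $i<k$; $Z_{i,j}Z_{s,t}=Z_{s,t}Z_{i,j}$ if $i<s$, $t<j$; $Z_{i,j}Z_{s,t}=Z_{s,t}Z_{i,j}+(q-q^{-1})Z_{i,t}Z_{s,j}$ if $i<s$, $j<t$. $\mathcal S$ is the semidirect (smash) product of the Laurent polynomial ring in the commuting invertible variables $L(\lambda_\beta)$, $L(\lambda_{\mu_k})$, $L(\lambda_{\nu_k})$ ($1\le k\le n-1$) with $M_q(n)$: as a vector space it is $M_q(n)$ tensor the Laurent polynomial ring, both factors are subalgebras, and $L(\lambda_\beta)Z_{i,j}=qZ_{i,j}L(\lambda_\beta)$, $L(\lambda_{\mu_k})Z_{i,j}=q^{[k<i]}Z_{i,j}L(\lambda_{\mu_k})$, $L(\lambda_{\nu_k})Z_{i,j}=q^{[k<j]}Z_{i,j}L(\lambda_{\nu_k})$, where $[\cdot]$ is $1$ if the condition holds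 and $0$ otherwise. (It is a subalgebra of the quantized enveloping algebra $\mathcal U_q(A_{2n-1})$.) By convention $L(\lambda_{\mu_n})=L(\lambda_{\nu_n})=1$. For $p\in\mathbb C^*$, $D_p(n)$ is the Dipper–Donkin algebra with generators $D_{i,j}$, $1\le i,j\le n$, and relations $D_{i,j}D_{s,t}=pD_{s,t}D_{i,j}$ if $i>s$ and $j\le t$; $D_{i,j}D_{s,t}=D_{s,t}D_{i,j}+(p-1)D_{s,j}D_{i,t}$ if $i>s$ and $j>t$; $D_{i,j}D_{i,k}=D_{i,k}D_{i,j}$ for all $i,j,k$. *)

theory Defs
  imports "HOL-Algebra.Algebra" "HOL-Library.Poly_Mapping" Complex_Main
begin

section \<open>Associative unital complex algebras as records\<close>

text \<open>A complex algebra is a record of type \<^typ>\<open>(complex, 'a) module\<close>: a (not necessarily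
  commutative) ring together with a scalar multiplication. (The locale \<^locale>\<open>algebra\<close> of
  HOL-Algebra cannot be used, since it requires the ring to be commutative.)\<close>

definition subalgebra_of :: "'a set \<Rightarrow> (complex, 'a) module \<Rightarrow> bool" where
  "subalgebra_of H A \<longleftrightarrow> subring H A \<and> (\<forall>c. \<forall>x\<in>H. c \<odot>\<^bsub>A\<^esub> x \<in> H)"

definition generated_subalgebra :: "(complex, 'a) module \<Rightarrow> 'a set \<Rightarrow> (complex, 'a) module" where
  "generated_subalgebra A B = A \<lparr>carrier := \<Inter>{H. subalgebra_of H A \<and> B \<subseteq> H}\<rparr>"

definition algebra_iso :: "(complex, 'a) module \<Rightarrow> (complex, 'b) module \<Rightarrow> ('a \<Rightarrow> 'b) set" where
  "algebra_iso A B =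
     {h \<in> ring_iso A B. \<forall>c. \<forall>x\<in>carrier A. h (c \<odot>\<^bsub>A\<^esub> x) = c \<odot>\<^bsub>B\<^esub> h x}"

definition algebra_isomorphic :: "(complex, 'a) module \<Rightarrow> (complex, 'b) module \<Rightarrow> bool" where
  "algebra_isomorphic A B \<longleftrightarrow> algebra_iso A B \<noteq> {}"

definition quotient_algebra :: "(complex, 'a) module \<Rightarrow> 'a set \<Rightarrow> (complex, 'a set) module" where
  "quotient_algebra A I =
     ring.extend (A Quot I)
       (module.fields (\<lambda>c C. (I +>\<^bsub>A\<^esub> (c \<odot>\<^bsub>A\<^esub> \<one>\<^bsub>A\<^esub>)) \<otimes>\<^bsub>A Quot I\<^esub> C))"


section \<open>Free algebras and presentations\<close>

text \<open>The type \<^typ>\<open>'x list\<close> is wrapped so that the free monoid becomes an instance of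
  \<^class>\<open>monoid_add\<close>. The convolution product of \<^theory>\<open>HOL-Library.Poly_Mapping\<close> then makes
  finitely supported functions on words the free associative algebra.\<close>

datatype 'x word = Word (letters: "'x list")

instantiation word :: (type) monoid_add
begin

definition zero_word :: "'a word" where
  "0 = Word []"

definition plus_word :: "'a word \<Rightarrow> 'a word \<Rightarrow> 'a word" where
  "u + v = Word (letters u @ letters v)"

instance
  by standard (simp_all add: zero_word_def plus_word_def)

end

type_synonym 'x free = "'x word \<Rightarrow>\<^sub>0 complex"

definition free_const :: "complex \<Rightarrow> 'x free" where
  "free_const c = Poly_Mapping.single 0 c"

definition free_gen :: "'x \<Rightarrow> 'x free" where
  "free_gen x = Poly_Mapping.single (Word [x]) 1"

definition free_algebra :: "'x set \<Rightarrow> (complex, 'x free) module" where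
  "free_algebra V =
     \<lparr>carrier = {f. \<forall>w \<in> Poly_Mapping.keys f. set (letters w) \<subseteq> V},
      monoid.mult = (*), one = 1, ring.zero = 0, add = (+),
      smult = (\<lambda>c f. free_const c * f)\<rparr>"

lemma letters_zero [simp]: "letters 0 = []"
  by (simp add: zero_word_def)

lemma letters_plus [simp]: "letters (u + v) = letters u @ letters v"
  by (simp add: plus_word_def)

lemma ring_free_algebra: "ring (free_algebra V)"
proof (rule ringI)
  show "abelian_group (free_algebra V)"
  proof (rule abelian_groupI)
    fix f assume "f \<in> carrier (free_algebra V)"
    then show "\<exists>g\<in>carrier (free_algebra V). g \<oplus>\<^bsub>free_algebra V\<^esub> f = \<zero>\<^bsub>free_algebra V\<^esub>"
      by (intro bexI[of _ "- f"]) (auto simp: free_algebra_def)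
  next
    fix f g assume "f \<in> carrier (free_algebra V)" "g \<in> carrier (free_algebra V)"
    then show "f \<oplus>\<^bsub>free_algebra V\<^esub> g \<in> carrier (free_algebra V)"
      using Poly_Mapping.keys_add[of f g] by (fastforce simp: free_algebra_def)
  qed (auto simp: free_algebra_def add_ac)
  show "monoid (free_algebra V)"
  proof (rule monoidI)
    fix f g assume "f \<in> carrier (free_algebra V)" "g \<in> carrier (free_algebra V)"
    then show "f \<otimes>\<^bsub>free_algebra V\<^esub> g \<in> carrier (free_algebra V)"
      using Poly_Mapping.keys_mult[of f g] by (fastforce simp: free_algebra_def)
  qed (auto simp: free_algebra_def mult.assoc)
qed (auto simp: free_algebra_def algebra_simps)

definition presented_algebra :: "'x set \<Rightarrow> 'x free set \<Rightarrow> (complex, 'x free set) module" where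
  "presented_algebra V R = quotient_algebra (free_algebra V) (Idl\<^bsub>free_algebra V\<^esub> R)"

definition presented_gen :: "'x set \<Rightarrow> 'x free set \<Rightarrow> 'x \<Rightarrow> 'x free set" where
  "presented_gen V R x = (Idl\<^bsub>free_algebra V\<^esub> R) +>\<^bsub>free_algebra V\<^esub> free_gen x"


section \<open>Quantized matrix algebras and Dipper--Donkin algebras\<close>

definition idx :: "nat \<Rightarrow> (nat \<times> nat) set" where
  "idx n = {1..n} \<times> {1..n}"

definition Mq_rels :: "complex \<Rightarrow> nat \<Rightarrow> (nat \<times> nat) free set" where
  "Mq_rels q n =
     (let Z = (\<lambda>i j. free_gen (i, j)) in
       {Z i j * Z i k - free_const q * (Z i k * Z i j) | i j k.
          i \<in> {1..n} \<and> j \<in> {1..n} \<and> k \<in> {1..n} \<and> j < k}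
     \<union> {Z i j * Z k j - free_const q * (Z k j * Z i j) | i j k.
          i \<in> {1..n} \<and> j \<in> {1..n} \<and> k \<in> {1..n} \<and> i < k}
     \<union> {Z i j * Z s t - Z s t * Z i j | i j s t.
          i \<in> {1..n} \<and> j \<in> {1..n} \<and> s \<in> {1..n} \<and> t \<in> {1..n} \<and> i < s \<and> t < j}
     \<union> {Z i j * Z s t - (Z s t * Z i j + free_const (q - inverse q) * (Z i t * Z s j)) | i j s t.
          i \<in> {1..n} \<and> j \<in> {1..n} \<and> s \<in> {1..n} \<and> t \<in> {1..n} \<and> i < s \<and> j < t})"

definition Mq :: "complex \<Rightarrow> nat \<Rightarrow> (complex, (nat \<times> nat) free set) module" where
  "Mq q n = presented_algebra (idx n) (Mq_rels q n)"

definition Mq_gen :: "complex \<Rightarrow> nat \<Rightarrow> nat \<Rightarrow> nat \<Rightarrow> (nat \<times> nat) free set" where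
  "Mq_gen q n i j = presented_gen (idx n) (Mq_rels q n) (i, j)"

definition DD_rels :: "complex \<Rightarrow> nat \<Rightarrow> (nat \<times> nat) free set" where
  "DD_rels p n =
     (let D = (\<lambda>i j. free_gen (i, j)) in
       {D i j * D s t - free_const p * (D s t * D i j) | i j s t.
          i \<in> {1..n} \<and> j \<in> {1..n} \<and> s \<in> {1..n} \<and> t \<in> {1..n} \<and> i > s \<and> j \<le> t}
     \<union> {D i j * D s t - (D s t * D i j + free_const (p - 1) * (D s j * D i t)) | i j s t.
          i \<in> {1..n} \<and> j \<in> {1..n} \<and> s \<in> {1..n} \<and> t \<in> {1..n} \<and> i > s \<and> j > t}
     \<union> {D i j * D i k - D i k * D i j | i j k.
          i \<in> {1..n} \<and> j \<in> {1..n} \<and> k \<in> {1..n}})"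

definition DD :: "complex \<Rightarrow> nat \<Rightarrow> (complex, (nat \<times> nat) free set) module" where
  "DD p n = presented_algebra (idx n) (DD_rels p n)"


section \<open>Smash products with Laurent polynomial rings\<close>

text \<open>Let \<open>G\<close> be a subgroup of an abelian group (written additively) acting on the algebra \<open>A\<close> by
  automorphisms \<open>act\<close>. The underlying space of the smash product is \<open>A\<close> tensor the group algebra
  of \<open>G\<close>: the function \<open>f\<close> stands for the sum of all \<open>f \<alpha> \<otimes> x\<^sup>\<alpha>\<close>, and
  \<open>(a \<otimes> x\<^sup>\<alpha>)(b \<otimes> x\<^sup>\<beta>) = a (act \<alpha> b) \<otimes> x\<^bsup>\<alpha>+\<beta>\<^esup>\<close>.\<close>

definition smash ::
  "(complex, 'a) module \<Rightarrow> 'g::ab_group_add set \<Rightarrow> ('g \<Rightarrow> 'a \<Rightarrow> 'a) \<Rightarrow> (complex, 'g \<Rightarrow> 'a) module" where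
  "smash A G act =
     \<lparr>carrier = {f. (\<forall>\<alpha>. f \<alpha> \<in> carrier A) \<and> (\<forall>\<alpha>. \<alpha> \<notin> G \<longrightarrow> f \<alpha> = \<zero>\<^bsub>A\<^esub>) \<and> finite {\<alpha>. f \<alpha> \<noteq> \<zero>\<^bsub>A\<^esub>}},
      monoid.mult = (\<lambda>f g \<gamma>. \<Oplus>\<^bsub>A\<^esub>\<alpha>\<in>{\<alpha>. f \<alpha> \<noteq> \<zero>\<^bsub>A\<^esub>}. f \<alpha> \<otimes>\<^bsub>A\<^esub> act \<alpha> (g (\<gamma> - \<alpha>))),
      one = (\<lambda>\<gamma>. if \<gamma> = 0 then \<one>\<^bsub>A\<^esub> else \<zero>\<^bsub>A\<^esub>),
      ring.zero = (\<lambda>\<gamma>. \<zero>\<^bsub>A\<^esub>),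
      add = (\<lambda>f g \<gamma>. f \<gamma> \<oplus>\<^bsub>A\<^esub> g \<gamma>),
      smult = (\<lambda>c f \<gamma>. c \<odot>\<^bsub>A\<^esub> f \<gamma>)\<rparr>"

definition smash_tensor :: "(complex, 'a) module \<Rightarrow> 'a \<Rightarrow> 'g \<Rightarrow> 'g \<Rightarrow> 'a" where
  "smash_tensor A a \<alpha> = (\<lambda>\<gamma>. if \<gamma> = \<alpha> then a else \<zero>\<^bsub>A\<^esub>)"


section \<open>The semidirect product\<close>

text \<open>The Laurent variables \<open>L(\<lambda>\<^sub>\<beta>)\<close>, \<open>L(\<lambda>\<^sub>\<mu>\<^sub>k)\<close>, \<open>L(\<lambda>\<^sub>\<nu>\<^sub>k)\<close>; Laurent monomials are given by their
  exponents, of type \<open>lvar \<Rightarrow>\<^sub>0 int\<close>.\<close>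

datatype lvar = Beta | Mu nat | Nu nat

definition lvars :: "nat \<Rightarrow> lvar set" where
  "lvars n = {Beta} \<union> Mu ` {1..<n} \<union> Nu ` {1..<n}"

definition lexps :: "nat \<Rightarrow> (lvar \<Rightarrow>\<^sub>0 int) set" where
  "lexps n = {\<alpha>. Poly_Mapping.keys \<alpha> \<subseteq> lvars n}"

fun lvar_wt :: "lvar \<Rightarrow> nat \<times> nat \<Rightarrow> int" where
  "lvar_wt Beta (i, j) = 1"
| "lvar_wt (Mu k) (i, j) = of_bool (k < i)"
| "lvar_wt (Nu k) (i, j) = of_bool (k < j)"

definition wt :: "(lvar \<Rightarrow>\<^sub>0 int) \<Rightarrow> nat \<times> nat \<Rightarrow> int" where
  "wt \<alpha> x = (\<Sum>v \<in> Poly_Mapping.keys \<alpha>. Poly_Mapping.lookup \<alpha> v * lvar_wt v x)"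

text \<open>The automorphism \<open>Z\<^sub>i\<^sub>j \<mapsto> q\<^bsup>wt \<alpha> (i, j)\<^esup> Z\<^sub>i\<^sub>j\<close> of the free algebra. It preserves the ideal
  defining \<^const>\<open>Mq\<close>, so its image map on cosets is the induced automorphism of \<^const>\<open>Mq\<close>.\<close>

definition free_scale :: "complex \<Rightarrow> (lvar \<Rightarrow>\<^sub>0 int) \<Rightarrow> (nat \<times> nat) free \<Rightarrow> (nat \<times> nat) free" where
  "free_scale q \<alpha> =
     Poly_Mapping.mapp (\<lambda>w c. (\<Prod>x\<leftarrow>letters w. q powi wt \<alpha> x) * c)"

definition S_alg ::
  "complex \<Rightarrow> nat \<Rightarrow> (complex, (lvar \<Rightarrow>\<^sub>0 int) \<Rightarrow> (nat \<times> nat) free set) module" where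
  "S_alg q n = smash (Mq q n) (lexps n) (\<lambda>\<alpha> C. free_scale q \<alpha> ` C)"

definition S_Z :: "complex \<Rightarrow> nat \<Rightarrow> nat \<Rightarrow> nat \<Rightarrow> (lvar \<Rightarrow>\<^sub>0 int) \<Rightarrow> (nat \<times> nat) free set" where
  "S_Z q n i j = smash_tensor (Mq q n) (Mq_gen q n i j) 0"

definition S_L :: "complex \<Rightarrow> nat \<Rightarrow> lvar \<Rightarrow> (lvar \<Rightarrow>\<^sub>0 int) \<Rightarrow> (nat \<times> nat) free set" where
  "S_L q n v = smash_tensor (Mq q n) \<one>\<^bsub>Mq q n\<^esub> (Poly_Mapping.single v 1)"

text \<open>By convention the elements with index \<open>n\<close> are \<open>1\<close>; only indices \<open>1, \<dots>, n\<close> are used.\<close>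

definition L_mu :: "complex \<Rightarrow> nat \<Rightarrow> nat \<Rightarrow> (lvar \<Rightarrow>\<^sub>0 int) \<Rightarrow> (nat \<times> nat) free set" where
  "L_mu q n k = (if k = n then \<one>\<^bsub>S_alg q n\<^esub> else S_L q n (Mu k))"

definition L_nu :: "complex \<Rightarrow> nat \<Rightarrow> nat \<Rightarrow> (lvar \<Rightarrow>\<^sub>0 int) \<Rightarrow> (nat \<times> nat) free set" where
  "L_nu q n k = (if k = n then \<one>\<^bsub>S_alg q n\<^esub> else S_L q n (Nu k))"

definition D_tilde ::
  "complex \<Rightarrow> nat \<Rightarrow> nat \<Rightarrow> nat \<Rightarrow> (lvar \<Rightarrow>\<^sub>0 int) \<Rightarrow> (nat \<times> nat) free set" where
  "D_tilde q n i j = S_Z q n i j \<otimes>\<^bsub>S_alg q n\<^esub> inv\<^bsub>S_alg q n\<^esub> (L_mu q n i) \<otimes>\<^bsub>S_alg q n\<^esub> L_nu q n j"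

definition D_tilde_alg ::
  "complex \<Rightarrow> nat \<Rightarrow> (complex, (lvar \<Rightarrow>\<^sub>0 int) \<Rightarrow> (nat \<times> nat) free set) module" where
  "D_tilde_alg q n =
     generated_subalgebra (S_alg q n) {D_tilde q n i j | i j. i \<in> {1..n} \<and> j \<in> {1..n}}"

end

theory Submission
  imports Defs
begin

text \<open>The isomorphism is the transposition of indices: it matches \<open>D\<^sub>i\<^sub>j\<close> with
  \<open>Z\<^sub>j\<^sub>i L(\<lambda>\<^sub>\<mu>\<^sub>j)\<^sup>-\<^sup>1 L(\<lambda>\<^sub>\<nu>\<^sub>i)\<close>. In a product of such elements the Laurent factors can be moved to
  the right at the cost of a scalar, so a word in the \<open>D\<^sub>i\<^sub>j\<close> goes to
  \<open>c(w) w \<otimes> x\<^sup>\<alpha>\<close>, where \<open>w\<close> is the transposed word in the \<open>Z\<^sub>i\<^sub>j\<close>, \<open>\<alpha>\<close> is the sum of the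
  Laurent exponents of its letters and \<open>c\<close> (called \<open>cocycle\<close> below) satisfies
  \<open>c(uv) = c(u) c(v) \<chi>(u, v)\<close>. The exponent \<open>\<alpha>\<close> and the factor \<open>\<chi>\<close> depend on the words only
  through the multisets of their row and column indices, and both sets of defining relations are
  homogeneous for this grading.

  Thus the Dipper--Donkin algebra is \<open>M\<^sub>q(n)\<close> with its product twisted by a cocycle, and the
  Laurent variables realise the twist. At the level of the free algebras: for homogeneous
  relations, rescaling words by such a \<open>c\<close> maps the ideal they generate into an ideal as soon as it
  does so for the relations themselves (\<open>twist_genideal\<close>). A direct calculation with words of length
  two checks the relations in both directions (\<open>twist_DD_rels\<close>, \<open>twist_Mq_rels\<close>). In one direction
  this shows that the relations of \<open>D\<^sub>p(n)\<close>, \<open>p = q\<^sup>-\<^sup>2\<close>, hold in the smash product, component by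
  component. In the other direction, if a noncommutative polynomial vanishes in the smash product,
  then each of its components lies in the ideal of \<open>M\<^sub>q(n)\<close>; untwisting puts each of them into the
  ideal of \<open>D\<^sub>p(n)\<close>, and their sum is the polynomial (\<open>D_tilde_eval_kernel\<close>). So the ideal of \<open>D\<^sub>p(n)\<close> is exactly the kernel, and
  the first isomorphism theorem (\<open>algebra_isomorphic_presented\<close>) concludes.\<close>

section \<open>Ideals of the free algebra and twisted relabellings\<close>

lemma free_algebra_simps [simp]:
  "monoid.mult (free_algebra V) = (*)" "one (free_algebra V) = 1"
  "ring.zero (free_algebra V) = 0" "add (free_algebra V) = (+)"
  "module.smult (free_algebra V) = (\<lambda>c f. free_const c * f)"
  by (simp_all add: free_algebra_def)

lemma mem_free_algebra:
  "f \<in> carrier (free_algebra V) \<longleftrightarrow> (\<forall>w \<in> Poly_Mapping.keys f. set (letters w) \<subseteq> V)"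
  by (simp add: free_algebra_def)

lemma free_algebra_closed [simp]:
  "0 \<in> carrier (free_algebra V)" "1 \<in> carrier (free_algebra V)"
  "free_const c \<in> carrier (free_algebra V)"
  "f \<in> carrier (free_algebra V) \<Longrightarrow> - f \<in> carrier (free_algebra V)"
  "f \<in> carrier (free_algebra V) \<Longrightarrow> g \<in> carrier (free_algebra V) \<Longrightarrow> f + g \<in> carrier (free_algebra V)"
  "f \<in> carrier (free_algebra V) \<Longrightarrow> g \<in> carrier (free_algebra V) \<Longrightarrow> f * g \<in> carrier (free_algebra V)"
  "f \<in> carrier (free_algebra V) \<Longrightarrow> g \<in> carrier (free_algebra V) \<Longrightarrow> f - g \<in> carrier (free_algebra V)"
  "set (letters w) \<subseteq> V \<Longrightarrow> Poly_Mapping.single w c \<in> carrier (free_algebra V)"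
proof -
  interpret ring "free_algebra V" by (rule ring_free_algebra)
  show add: "f + g \<in> carrier (free_algebra V)"
    if "f \<in> carrier (free_algebra V)" "g \<in> carrier (free_algebra V)" for f g
    using add.m_closed[of f g] that by simp
  show "f * g \<in> carrier (free_algebra V)"
    if "f \<in> carrier (free_algebra V)" "g \<in> carrier (free_algebra V)" for f g
    using m_closed[of f g] that by simp
  show neg: "- f \<in> carrier (free_algebra V)" if "f \<in> carrier (free_algebra V)" for f
    using that by (simp add: mem_free_algebra)
  show "f - g \<in> carrier (free_algebra V)"
    if "f \<in> carrier (free_algebra V)" "g \<in> carrier (free_algebra V)" for f g
    using add[of f "- g"] neg[of g] that by simp
qed (auto simp: mem_free_algebra free_const_def)

lemma free_const_mult_single:
  "free_const c * Poly_Mapping.single w d = Poly_Mapping.single w (c * d)"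
  by (simp add: free_const_def mult_single)

lemma free_algebra_sum_closed:
  assumes "\<And>i. i \<in> B \<Longrightarrow> F i \<in> carrier (free_algebra V)"
  shows "(\<Sum>i\<in>B. F i) \<in> carrier (free_algebra V)"
  using assms by (induction B rule: infinite_finite_induct) auto

lemma sum_monomials:
  assumes "finite B" "Poly_Mapping.keys f \<subseteq> B"
  shows "f = (\<Sum>w\<in>B. Poly_Mapping.single w (Poly_Mapping.lookup f w))"
proof (rule poly_mapping_eqI)
  fix v
  have "(\<Sum>w\<in>B. Poly_Mapping.lookup (Poly_Mapping.single w (Poly_Mapping.lookup f w)) v)
      = (\<Sum>w\<in>B. if w = v then Poly_Mapping.lookup f v else 0)"
    by (rule sum.cong) (auto simp: lookup_single when_def)
  also have "\<dots> = Poly_Mapping.lookup f v"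
    using assms by (auto simp: in_keys_iff)
  finally show "Poly_Mapping.lookup f v
      = Poly_Mapping.lookup (\<Sum>w\<in>B. Poly_Mapping.single w (Poly_Mapping.lookup f w)) v"
    by (simp add: lookup_sum)
qed

lemma free_const_central: "f * free_const c = free_const c * f"
proof -
  have *: "f = (\<Sum>w\<in>Poly_Mapping.keys f. Poly_Mapping.single w (Poly_Mapping.lookup f w))"
    by (rule sum_monomials) auto
  show ?thesis
    by (subst (1 2) *)
      (simp add: sum_distrib_left sum_distrib_right free_const_def mult_single mult.commute)
qed

lemma lookup_free_const_mult:
  "Poly_Mapping.lookup (free_const c * f) w = c * Poly_Mapping.lookup f w"
proof -
  have *: "free_const c * f = (\<Sum>w\<in>Poly_Mapping.keys f. Poly_Mapping.single w (c * Poly_Mapping.lookup f w))"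
    by (subst (1) sum_monomials[OF finite_keys subset_refl])
      (simp add: sum_distrib_left free_const_mult_single)
  have "Poly_Mapping.lookup (free_const c * f) w
      = (\<Sum>v\<in>Poly_Mapping.keys f. if v = w then c * Poly_Mapping.lookup f w else 0)"
    unfolding * lookup_sum by (rule sum.cong) (auto simp: lookup_single when_def)
  then show ?thesis by (simp add: in_keys_iff)
qed

lemma free_ideal_iff:
  "ideal I (free_algebra V) \<longleftrightarrow>
     I \<subseteq> carrier (free_algebra V) \<and> 0 \<in> I \<and> (\<forall>f\<in>I. \<forall>g\<in>I. f + g \<in> I) \<and>
     (\<forall>f\<in>I. \<forall>g\<in>carrier (free_algebra V). g * f \<in> I \<and> f * g \<in> I)"
  (is "?L \<longleftrightarrow> ?R")
proof
  assume ?L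
  then interpret ideal I "free_algebra V" .
  show ?R
    using a_subset additive_subgroup.zero_closed[OF additive_subgroup_axioms]
      additive_subgroup.a_closed[OF additive_subgroup_axioms] I_l_closed I_r_closed by auto
next
  interpret F: ring "free_algebra V" by (rule ring_free_algebra)
  assume R: ?R
  show ?L
  proof (rule idealI)
    show "subgroup I (add_monoid (free_algebra V))"
    proof (rule F.add.subgroupI)
      fix f assume "f \<in> I"
      then have "free_const (-1) * f \<in> I" "f \<in> carrier (free_algebra V)" using R by auto
      moreover have "free_const (-1) * f = - f"
        by (simp add: free_const_def single_uminus)
      moreover have "\<ominus>\<^bsub>free_algebra V\<^esub> f = - f" 
        by (rule F.minus_equality) (use calculation in auto)
      ultimately show "\<ominus>\<^bsub>free_algebra V\<^esub> f \<in> I" by simp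
    qed (use R in auto)
  qed (use R ring_free_algebra in auto)
qed

text \<open>The linear map sending a word \<open>w\<close> to \<open>k w\<close> times its relabelling along \<open>\<sigma>\<close>. For
  \<open>k = (\<lambda>_. 1)\<close> this is the algebra homomorphism induced by \<open>\<sigma>\<close>; the maps used below are
  multiplicative only up to scalars.\<close>

definition twist :: "('x \<Rightarrow> 'y) \<Rightarrow> ('x word \<Rightarrow> complex) \<Rightarrow> 'x free \<Rightarrow> 'y free" where
  "twist \<sigma> k f =
     (\<Sum>w\<in>Poly_Mapping.keys f. Poly_Mapping.single (map_word \<sigma> w) (k w * Poly_Mapping.lookup f w))"

lemma letters_map_word [simp]: "letters (map_word \<sigma> w) = map \<sigma> (letters w)"
  by (cases w) simp

lemma map_word_plus: "map_word \<sigma> (u + v) = map_word \<sigma> u + map_word \<sigma> v"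
  by (simp add: plus_word_def word.expand)

lemma map_word_zero [simp]: "map_word \<sigma> 0 = 0"
  by (simp add: zero_word_def)

lemma twist_superset:
  assumes "finite B" "Poly_Mapping.keys f \<subseteq> B"
  shows "twist \<sigma> k f =
    (\<Sum>w\<in>B. Poly_Mapping.single (map_word \<sigma> w) (k w * Poly_Mapping.lookup f w))"
  unfolding twist_def using assms by (intro sum.mono_neutral_left) (auto simp: in_keys_iff)

lemma twist_add: "twist \<sigma> k (f + g) = twist \<sigma> k f + twist \<sigma> k g"
proof -
  let ?B = "Poly_Mapping.keys f \<union> Poly_Mapping.keys g"
  have "Poly_Mapping.keys (f + g) \<subseteq> ?B" by (rule Poly_Mapping.keys_add)
  then show ?thesis
    by (subst (1 2 3) twist_superset[of ?B])
      (auto simp: lookup_add distrib_left single_add sum.distrib)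
qed

lemma twist_zero [simp]: "twist \<sigma> k 0 = 0"
  by (simp add: twist_def)

lemma twist_sum: "twist \<sigma> k (\<Sum>i\<in>B. F i) = (\<Sum>i\<in>B. twist \<sigma> k (F i))"
  by (induction B rule: infinite_finite_induct) (auto simp: twist_add)

lemma twist_single [simp]:
  "twist \<sigma> k (Poly_Mapping.single w c) = Poly_Mapping.single (map_word \<sigma> w) (k w * c)"
  by (simp add: twist_def)

lemma twist_smult: "twist \<sigma> k (free_const c * f) = free_const c * twist \<sigma> k f"
proof -
  have "Poly_Mapping.keys (free_const c * f) \<subseteq> Poly_Mapping.keys f"
    by (auto simp: in_keys_iff lookup_free_const_mult)
  then show ?thesis
    by (subst (1 2) twist_superset[of "Poly_Mapping.keys f"])
      (auto simp: lookup_free_const_mult sum_distrib_left free_const_mult_single mult_ac)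
qed

lemma twist_uminus: "twist \<sigma> k (- f) = - twist \<sigma> k f"
  using twist_add[of \<sigma> k f "- f"] by (simp add: eq_neg_iff_add_eq_0 add.commute)

lemma twist_diff: "twist \<sigma> k (f - g) = twist \<sigma> k f - twist \<sigma> k g"
  using twist_add[of \<sigma> k f "- g"] by (simp add: twist_uminus)

lemma twist_closed:
  assumes "f \<in> carrier (free_algebra V)" "\<sigma> ` V \<subseteq> V'"
  shows "twist \<sigma> k f \<in> carrier (free_algebra V')"
  unfolding twist_def
proof (rule free_algebra_sum_closed)
  fix w assume "w \<in> Poly_Mapping.keys f"
  then have "set (letters w) \<subseteq> V" using assms by (auto simp: mem_free_algebra)
  then have "set (letters (map_word \<sigma> w)) \<subseteq> V'" using assms by auto
  then show "Poly_Mapping.single (map_word \<sigma> w) (k w * Poly_Mapping.lookup f w)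
      \<in> carrier (free_algebra V')" by simp
qed

lemma twist_twist: "twist \<sigma> k (twist \<tau> l f) = twist (\<sigma> \<circ> \<tau>) (\<lambda>w. k (map_word \<tau> w) * l w) f"
  unfolding twist_def[of \<tau>] twist_sum
  by (simp add: twist_def[of "\<sigma> \<circ> \<tau>"] word.map_comp mult_ac)

lemma twist_id: 
  assumes "\<And>w. w \<in> Poly_Mapping.keys f \<Longrightarrow> k w = 1" "\<And>x. \<sigma> x = x"
  shows "twist \<sigma> k f = f"
proof -
  have "\<sigma> = id" using assms(2) by auto
  then show ?thesis
    unfolding twist_def using assms(1)
    by (subst (3) sum_monomials[OF finite_keys subset_refl]) (auto intro!: sum.cong simp: word.map_id)
qed

text \<open>A twist need not be multiplicative, so it does not map generated ideals to ideals for free.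
  The image of \<open>u r v\<close>, for words \<open>u\<close>, \<open>v\<close> and a relation \<open>r\<close>, is nevertheless a scalar
  multiple of the image of \<open>r\<close> between two words as soon as the factor that \<open>k\<close> acquires from
  the surroundings takes one value on all words of \<open>r\<close>. This is what the grading \<open>\<kappa>\<close> ensures.
  Since \<open>m\<close> may vanish, projections onto homogeneous components are covered as well.\<close>

lemma twist_genideal:
  assumes R: "R \<subseteq> carrier (free_algebra V)"
    and homogeneous: "\<And>r. r \<in> R \<Longrightarrow> \<exists>w\<^sub>0. \<forall>w\<in>Poly_Mapping.keys r. \<kappa> w = \<kappa> w\<^sub>0"
    and k: "\<And>u w v. k (u + w + v) = m u w v * k\<^sub>0 w"
    and m: "\<And>u v w w'. \<kappa> w = \<kappa> w' \<Longrightarrow> m u w v = m u w' v"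
    and J: "ideal J (free_algebra V')" and \<sigma>: "\<sigma> ` V \<subseteq> V'"
    and rels: "\<And>r. r \<in> R \<Longrightarrow> twist \<sigma> k\<^sub>0 r \<in> J"
    and f: "f \<in> Idl\<^bsub>free_algebra V\<^esub> R"
  shows "twist \<sigma> k f \<in> J"
proof -
  interpret F: ring "free_algebra V" by (rule ring_free_algebra)
  let ?F = "carrier (free_algebra V)"
  let ?m = "\<lambda>u. Poly_Mapping.single u (1::complex)"
  let ?c = "Poly_Mapping.lookup"
  define K where "K = {f \<in> ?F. \<forall>u v. set (letters u) \<subseteq> V \<longrightarrow> set (letters v) \<subseteq> V
      \<longrightarrow> twist \<sigma> k (?m u * f * ?m v) \<in> J}"
  have J0: "0 \<in> J" and Jadd: "\<And>f g. f \<in> J \<Longrightarrow> g \<in> J \<Longrightarrow> f + g \<in> J"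
    and Jl: "\<And>f g. f \<in> J \<Longrightarrow> g \<in> carrier (free_algebra V') \<Longrightarrow> g * f \<in> J"
    and Jr: "\<And>f g. f \<in> J \<Longrightarrow> g \<in> carrier (free_algebra V') \<Longrightarrow> f * g \<in> J"
    using J by (auto simp: free_ideal_iff)
  have Jsum: "(\<Sum>i\<in>B. G i) \<in> J" if "\<And>i. i \<in> B \<Longrightarrow> G i \<in> J" for G and B :: "'a word set"
    using that by (induction B rule: infinite_finite_induct) (auto simp: J0 Jadd)
  have "ideal K (free_algebra V)"
    unfolding free_ideal_iff
  proof (intro conjI ballI)
    show "K \<subseteq> ?F" "0 \<in> K" by (auto simp: K_def J0)
    show "f + g \<in> K" if "f \<in> K" "g \<in> K" for f g
      using that by (auto simp: K_def distrib_left distrib_right twist_add Jadd)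
    fix f g assume f: "f \<in> K" and g: "g \<in> ?F"
    have g_eq: "g = (\<Sum>w\<in>Poly_Mapping.keys g. free_const (?c g w) * ?m w)"
      by (subst sum_monomials[OF finite_keys subset_refl]) (simp add: free_const_mult_single)
    show "g * f \<in> K"
      unfolding K_def
    proof (intro CollectI conjI allI impI)
      show "g * f \<in> ?F" using f g by (simp add: K_def)
      fix u v assume uv: "set (letters u) \<subseteq> V" "set (letters v) \<subseteq> V"
      have "?m u * (g * f) * ?m v =
          (\<Sum>w\<in>Poly_Mapping.keys g. free_const (?c g w) * (?m (u + w) * f * ?m v))"
      proof (subst g_eq, unfold sum_distrib_left sum_distrib_right, rule sum.cong[OF refl])
        fix w
        have "?m u * (free_const (?c g w) * ?m w * f) * ?m v
            = (?m u * free_const (?c g w)) * ?m w * f * ?m v" by (simp only: mult.assoc)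
        also have "\<dots> = free_const (?c g w) * (?m u * ?m w * f * ?m v)"
          by (simp only: free_const_central mult.assoc)
        finally show "?m u * (free_const (?c g w) * ?m w * f) * ?m v
            = free_const (?c g w) * (?m (u + w) * f * ?m v)" by (simp add: mult_single)
      qed
      then have *: "twist \<sigma> k (?m u * (g * f) * ?m v) =
          (\<Sum>w\<in>Poly_Mapping.keys g. free_const (?c g w) * twist \<sigma> k (?m (u + w) * f * ?m v))"
        by (simp add: twist_sum twist_smult)
      show "twist \<sigma> k (?m u * (g * f) * ?m v) \<in> J"
        unfolding * using f g uv
        by (intro Jsum Jl free_algebra_closed(3)) (auto simp: K_def mem_free_algebra)
    qed
    show "f * g \<in> K"
      unfolding K_def
    proof (intro CollectI conjI allI impI)
      show "f * g \<in> ?F" using f g by (simp add: K_def)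
      fix u v assume uv: "set (letters u) \<subseteq> V" "set (letters v) \<subseteq> V"
      have "?m u * (f * g) * ?m v =
          (\<Sum>w\<in>Poly_Mapping.keys g. free_const (?c g w) * (?m u * f * ?m (w + v)))"
      proof (subst g_eq, unfold sum_distrib_left sum_distrib_right, rule sum.cong[OF refl])
        fix w
        have "?m u * (f * (free_const (?c g w) * ?m w)) * ?m v
            = (?m u * f * free_const (?c g w)) * ?m w * ?m v" by (simp only: mult.assoc)
        also have "\<dots> = free_const (?c g w) * (?m u * f * (?m w * ?m v))"
          by (simp only: free_const_central mult.assoc)
        finally show "?m u * (f * (free_const (?c g w) * ?m w)) * ?m v
            = free_const (?c g w) * (?m u * f * ?m (w + v))" by (simp add: mult_single)
      qed
      then have *: "twist \<sigma> k (?m u * (f * g) * ?m v) =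
          (\<Sum>w\<in>Poly_Mapping.keys g. free_const (?c g w) * twist \<sigma> k (?m u * f * ?m (w + v)))"
        by (simp add: twist_sum twist_smult)
      show "twist \<sigma> k (?m u * (f * g) * ?m v) \<in> J"
        unfolding * using f g uv
        by (intro Jsum Jl free_algebra_closed(3)) (auto simp: K_def mem_free_algebra)
    qed
  qed
  moreover have "R \<subseteq> K"
  proof
    fix r assume r: "r \<in> R"
    obtain w\<^sub>0 where w\<^sub>0: "\<And>w. w \<in> Poly_Mapping.keys r \<Longrightarrow> \<kappa> w = \<kappa> w\<^sub>0"
      using homogeneous[OF r] by auto
    show "r \<in> K"
      unfolding K_def
    proof (intro CollectI conjI allI impI)
      show "r \<in> ?F" using r R by auto
      fix u v assume uv: "set (letters u) \<subseteq> V" "set (letters v) \<subseteq> V"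
      have "?m u * r * ?m v = (\<Sum>w\<in>Poly_Mapping.keys r. Poly_Mapping.single (u + w + v) (?c r w))"
        by (subst sum_monomials[OF finite_keys subset_refl])
          (simp add: sum_distrib_left sum_distrib_right mult_single)
      then have "twist \<sigma> k (?m u * r * ?m v) = (\<Sum>w\<in>Poly_Mapping.keys r.
            Poly_Mapping.single (map_word \<sigma> (u + w + v)) (k (u + w + v) * ?c r w))"
        by (simp add: twist_sum)
      also have "\<dots> = (\<Sum>w\<in>Poly_Mapping.keys r. Poly_Mapping.single (map_word \<sigma> u) (m u w\<^sub>0 v) *
            Poly_Mapping.single (map_word \<sigma> w) (k\<^sub>0 w * ?c r w) * ?m (map_word \<sigma> v))"
        by (rule sum.cong) (simp_all add: k m[OF w\<^sub>0] map_word_plus mult_single mult.assoc)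
      also have "\<dots> = Poly_Mapping.single (map_word \<sigma> u) (m u w\<^sub>0 v) * twist \<sigma> k\<^sub>0 r * ?m (map_word \<sigma> v)"
        by (simp add: twist_def sum_distrib_left sum_distrib_right)
      also have "\<dots> \<in> J"
        using rels[OF r] uv \<sigma> by (intro Jl Jr free_algebra_closed) auto
      finally show "twist \<sigma> k (?m u * r * ?m v) \<in> J" .
    qed
  qed
  ultimately have "f \<in> K" using F.genideal_minimal f by blast
  then have "\<And>u v. set (letters u) \<subseteq> V \<Longrightarrow> set (letters v) \<subseteq> V \<Longrightarrow>
      twist \<sigma> k (?m u * f * ?m v) \<in> J"
    by (simp add: K_def)
  from this[of 0 0] show ?thesis by simp
qed

section \<open>Presented algebras\<close>

lemma quotient_algebra_simps [simp]:
  "carrier (quotient_algebra A I) = carrier (A Quot I)"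
  "monoid.mult (quotient_algebra A I) = monoid.mult (A Quot I)"
  "one (quotient_algebra A I) = one (A Quot I)"
  "ring.zero (quotient_algebra A I) = ring.zero (A Quot I)"
  "add (quotient_algebra A I) = add (A Quot I)"
  "module.smult (quotient_algebra A I) =
     (\<lambda>c C. (I +>\<^bsub>A\<^esub> (c \<odot>\<^bsub>A\<^esub> \<one>\<^bsub>A\<^esub>)) \<otimes>\<^bsub>A Quot I\<^esub> C)"
  by (simp_all add: quotient_algebra_def ring.defs module.defs)

lemma ring_quotient_algebra:
  assumes "ideal I A" shows "ring (quotient_algebra A I)"
proof -
  interpret Q: ring "A Quot I" using assms by (rule ideal.quotient_is_ring)
  show ?thesis
  proof (rule ringI)
    show "abelian_group (quotient_algebra A I)"
    proof (rule abelian_groupI)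
      show "\<exists>y\<in>carrier (quotient_algebra A I).
          y \<oplus>\<^bsub>quotient_algebra A I\<^esub> x = \<zero>\<^bsub>quotient_algebra A I\<^esub>"
        if "x \<in> carrier (quotient_algebra A I)" for x
        using that by (auto intro!: bexI[of _ "\<ominus>\<^bsub>A Quot I\<^esub> x"] Q.l_neg)
    qed (simp_all add: Q.a_ac)
    show "monoid (quotient_algebra A I)"
      by (rule monoidI) (auto simp: Q.m_assoc)
  qed (auto simp: Q.l_distr Q.r_distr)
qed

definition presented_class :: "'x set \<Rightarrow> 'x free set \<Rightarrow> 'x free \<Rightarrow> 'x free set" where
  "presented_class V R f = (Idl\<^bsub>free_algebra V\<^esub> R) +>\<^bsub>free_algebra V\<^esub> f"

locale presentation =
  fixes V :: "'x set" and R :: "'x free set"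
  assumes rels_closed: "R \<subseteq> carrier (free_algebra V)"
begin

abbreviation "I \<equiv> Idl\<^bsub>free_algebra V\<^esub> R"
abbreviation "cls \<equiv> presented_class V R"
abbreviation "P \<equiv> presented_algebra V R"

sublocale F: ring "free_algebra V" by (rule ring_free_algebra)

lemma ideal_rels: "ideal I (free_algebra V)"
  using rels_closed by (rule F.genideal_ideal)

sublocale I: ideal I "free_algebra V" by (rule ideal_rels)

sublocale P: ring "presented_algebra V R"
  unfolding presented_algebra_def using ideal_rels by (rule ring_quotient_algebra)

lemma rels_subset: "R \<subseteq> I"
  using rels_closed by (rule F.genideal_self)

lemma ideal_closed:
  "I \<subseteq> carrier (free_algebra V)" "0 \<in> I"
  "f \<in> I \<Longrightarrow> g \<in> I \<Longrightarrow> f + g \<in> I"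
  "f \<in> I \<Longrightarrow> g \<in> carrier (free_algebra V) \<Longrightarrow> g * f \<in> I"
  using ideal_rels by (auto simp: free_ideal_iff)

lemma cls_closed [simp]: "f \<in> carrier (free_algebra V) \<Longrightarrow> cls f \<in> carrier P"
  unfolding presented_algebra_def presented_class_def
  by (simp add: FactRing_def F.a_rcosetsI I.a_subset)

lemma carrier_presented: "carrier P = cls ` carrier (free_algebra V)"
  by (auto simp: presented_algebra_def presented_class_def FactRing_def A_RCOSETS_def' image_def)

lemma cls_add:
  "f \<in> carrier (free_algebra V) \<Longrightarrow> g \<in> carrier (free_algebra V) \<Longrightarrow>
     cls f \<oplus>\<^bsub>P\<^esub> cls g = cls (f + g)"
  using I.a_rcos_sum[of f g] by (simp add: presented_algebra_def presented_class_def FactRing_def)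

lemma cls_mult:
  "f \<in> carrier (free_algebra V) \<Longrightarrow> g \<in> carrier (free_algebra V) \<Longrightarrow>
     cls f \<otimes>\<^bsub>P\<^esub> cls g = cls (f * g)"
  using I.rcoset_mult_add[of f g] by (simp add: presented_algebra_def presented_class_def FactRing_def)

lemma one_presented: "\<one>\<^bsub>P\<^esub> = cls 1"
  by (simp add: presented_algebra_def presented_class_def FactRing_def)

lemma cls_eq_iff:
  assumes "f \<in> carrier (free_algebra V)" "g \<in> carrier (free_algebra V)"
  shows "cls f = cls g \<longleftrightarrow> f - g \<in> I"
proof
  assume "cls f = cls g"
  moreover have "f \<in> cls f"
    using ideal_closed(2) by (force simp: presented_class_def a_r_coset_def')
  ultimately have "f \<in> cls g" by simp
  then have "f \<in> I +>\<^bsub>free_algebra V\<^esub> g" by (simp add: presented_class_def)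
  then show "f - g \<in> I" by (auto simp: a_r_coset_def')
next
  assume "f - g \<in> I"
  then have "f \<in> I +>\<^bsub>free_algebra V\<^esub> g" by (force simp: a_r_coset_def')
  then show "cls f = cls g"
    unfolding presented_class_def using assms I.a_subgroup F.a_repr_independence by blast
qed

lemma zero_presented: "\<zero>\<^bsub>P\<^esub> = cls 0"
  using F.a_coset_add_zero[OF I.a_subset]
  by (simp add: presented_algebra_def presented_class_def FactRing_def)

lemma cls_eq_zero_iff:
  "f \<in> carrier (free_algebra V) \<Longrightarrow> cls f = \<zero>\<^bsub>P\<^esub> \<longleftrightarrow> f \<in> I"
  by (simp add: zero_presented cls_eq_iff)

lemma cls_smult:
  "f \<in> carrier (free_algebra V) \<Longrightarrow> c \<odot>\<^bsub>P\<^esub> cls f = cls (free_const c * f)"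
  using I.rcoset_mult_add[of "free_const c" f]
  by (simp add: presented_algebra_def presented_class_def FactRing_def)

lemma cls_sum:
  assumes "\<And>i. i \<in> B \<Longrightarrow> G i \<in> carrier (free_algebra V)" "finite B"
  shows "(\<Oplus>\<^bsub>P\<^esub>i\<in>B. cls (G i)) = cls (\<Sum>i\<in>B. G i)"
  using assms(2,1)
proof (induction B rule: finite_induct)
  case (insert i B)
  then show ?case
    by (subst P.finsum_insert) (auto simp: cls_add free_algebra_sum_closed)
qed (simp add: zero_presented)

lemma image_cls:
  assumes "\<And>f g. T (f + g) = T f + T g" "T ` I = I"
  shows "T ` cls f = cls (T f)"
proof -
  have "T ` cls f = (\<lambda>h. T h + T f) ` I"
    using assms(1) by (auto simp: presented_class_def a_r_coset_def' image_iff)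
  also have "\<dots> = (\<lambda>h. h + T f) ` T ` I" by (simp add: image_image)
  finally show ?thesis using assms(2) by (auto simp: presented_class_def a_r_coset_def')
qed

end

text \<open>First isomorphism theorem for a presented algebra. On the image of \<open>h\<close> the laws of the
  multiplication come from the free algebra; what \<open>A\<close> itself has to contribute are additive
  inverses, under which a subalgebra must be closed.\<close>

lemma algebra_isomorphic_presented:
  fixes A :: "(complex, 'a) module" and h :: "'x free \<Rightarrow> 'a"
  assumes R: "R \<subseteq> carrier (free_algebra V)"
    and A: "abelian_group A"
    and h_closed: "\<And>f. f \<in> carrier (free_algebra V) \<Longrightarrow> h f \<in> carrier A"
    and h_add: "\<And>f g. f \<in> carrier (free_algebra V) \<Longrightarrow> g \<in> carrier (free_algebra V) \<Longrightarrow>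
      h (f + g) = h f \<oplus>\<^bsub>A\<^esub> h g"
    and h_mult: "\<And>f g. f \<in> carrier (free_algebra V) \<Longrightarrow> g \<in> carrier (free_algebra V) \<Longrightarrow>
      h (f * g) = h f \<otimes>\<^bsub>A\<^esub> h g"
    and h_one: "h 1 = \<one>\<^bsub>A\<^esub>"
    and h_smult: "\<And>c f. f \<in> carrier (free_algebra V) \<Longrightarrow> h (free_const c * f) = c \<odot>\<^bsub>A\<^esub> h f"
    and kernel: "\<And>f. f \<in> carrier (free_algebra V) \<Longrightarrow>
      h f = \<zero>\<^bsub>A\<^esub> \<longleftrightarrow> f \<in> Idl\<^bsub>free_algebra V\<^esub> R"
  shows "algebra_isomorphic (generated_subalgebra A ((\<lambda>x. h (free_gen x)) ` V)) (presented_algebra V R)"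
proof -
  interpret presentation V R using R by unfold_locales
  interpret A: abelian_group A by (rule A)
  let ?F = "carrier (free_algebra V)" and ?X = "(\<lambda>x. h (free_gen x)) ` V"
  have h_zero: "h 0 = \<zero>\<^bsub>A\<^esub>" using kernel[of 0] ideal_closed(2) by simp
  have h_uminus: "\<ominus>\<^bsub>A\<^esub> h f = h (- f)" if "f \<in> ?F" for f
  proof (rule A.minus_equality)
    show "h (- f) \<oplus>\<^bsub>A\<^esub> h f = \<zero>\<^bsub>A\<^esub>"
      using h_add[of "- f" f] that by (simp add: h_zero)
  qed (use that h_closed in auto)
  have h_eq_iff: "h f = h g \<longleftrightarrow> cls f = cls g" if "f \<in> ?F" "g \<in> ?F" for f g
  proof -
    have "h f = h (f - g) \<oplus>\<^bsub>A\<^esub> h g"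
      using h_add[of "f - g" g] that by simp
    then have "h f = h g \<longleftrightarrow> h (f - g) = \<zero>\<^bsub>A\<^esub>"
      using that h_closed A.add.r_cancel_one by simp
    then show ?thesis using that kernel[of "f - g"] by (simp add: cls_eq_iff)
  qed
  have sub: "subalgebra_of (h ` ?F) A"
    unfolding subalgebra_of_def
  proof (intro conjI allI ballI)
    show "subring (h ` ?F) A"
    proof (intro subring.intro A.add.subgroupI submonoid.intro)
      fix a assume "a \<in> h ` ?F"
      then show "\<ominus>\<^bsub>A\<^esub> a \<in> h ` ?F" using h_uminus by auto
    qed (auto simp: h_closed simp flip: h_add h_mult h_one intro!: imageI)
    show "c \<odot>\<^bsub>A\<^esub> a \<in> h ` ?F" if "a \<in> h ` ?F" for c a
      using that by (auto simp flip: h_smult)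
  qed
  have least: "h ` ?F \<subseteq> H" if H: "subalgebra_of H A" and X: "?X \<subseteq> H" for H
  proof -
    have H': "subring H A" "\<And>c a. a \<in> H \<Longrightarrow> c \<odot>\<^bsub>A\<^esub> a \<in> H"
      using H by (auto simp: subalgebra_of_def)
    have words: "h (Poly_Mapping.single (Word xs) 1) \<in> H" if "set xs \<subseteq> V" for xs
      using that
    proof (induction xs)
      case Nil
      then show ?case using subringE(3)[OF H'(1)] h_one by (simp flip: zero_word_def)
    next
      case (Cons x xs)
      have "Poly_Mapping.single (Word (x # xs)) 1 = free_gen x * Poly_Mapping.single (Word xs) 1"
        by (simp add: free_gen_def mult_single plus_word_def)
      then have "h (Poly_Mapping.single (Word (x # xs)) 1)
          = h (free_gen x) \<otimes>\<^bsub>A\<^esub> h (Poly_Mapping.single (Word xs) 1)"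
        using Cons.prems by (simp add: h_mult free_gen_def)
      then show ?case using Cons subringE(6)[OF H'(1)] X by auto
    qed
    have monomials: "h (Poly_Mapping.single w c) \<in> H" if "set (letters w) \<subseteq> V" for w c
    proof -
      have "Poly_Mapping.single w c = free_const c * Poly_Mapping.single w 1"
        by (simp add: free_const_mult_single)
      then show ?thesis
        using words[of "letters w"] H'(2) that by (simp add: h_smult)
    qed
    have sums: "h (\<Sum>w\<in>B. Poly_Mapping.single w (Poly_Mapping.lookup f w)) \<in> H"
      if "f \<in> ?F" "B \<subseteq> Poly_Mapping.keys f" "finite B" for f B
      using that(3,2)
    proof (induction B rule: finite_induct)
      case empty
      then show ?case using subringE(2)[OF H'(1)] by (simp add: h_zero)
    next
      case (insert w B)
      moreover have "set (letters v) \<subseteq> V" if "v \<in> insert w B" for v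
        using that insert.prems \<open>f \<in> ?F\<close> unfolding mem_free_algebra by blast
      ultimately show ?case
        by (simp add: h_add free_algebra_sum_closed monomials subringE(7)[OF H'(1)])
    qed
    show ?thesis
    proof
      fix a assume "a \<in> h ` ?F"
      then obtain f where "f \<in> ?F" "a = h f" by auto
      then show "a \<in> H"
        using sums[of f "Poly_Mapping.keys f"] sum_monomials[OF finite_keys subset_refl, of f] by simp
    qed
  qed
  have gens: "?X \<subseteq> h ` ?F" by (auto simp: free_gen_def)
  have carrier_gen: "carrier (generated_subalgebra A ?X) = h ` ?F"
    unfolding generated_subalgebra_def using sub least gens by auto
  define \<phi> where "\<phi> = (\<lambda>a. cls (SOME f. f \<in> ?F \<and> h f = a))"
  have \<phi>: "\<phi> (h f) = cls f" if "f \<in> ?F" for f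
  proof -
    define g where "g = (SOME g. g \<in> ?F \<and> h g = h f)"
    have "g \<in> ?F \<and> h g = h f"
      unfolding g_def by (rule someI[of _ f]) (use that in auto)
    then show ?thesis using h_eq_iff[of g f] that by (simp add: \<phi>_def g_def)
  qed
  have ops: "monoid.mult (generated_subalgebra A ?X) = monoid.mult A"
    "one (generated_subalgebra A ?X) = one A" "add (generated_subalgebra A ?X) = add A"
    "module.smult (generated_subalgebra A ?X) = module.smult A"
    by (simp_all add: generated_subalgebra_def)
  have "\<phi> \<in> ring_iso (generated_subalgebra A ?X) P"
  proof (rule ring_iso_memI)
    show "\<phi> \<one>\<^bsub>generated_subalgebra A ?X\<^esub> = \<one>\<^bsub>P\<^esub>"
      using \<phi>[of 1] by (simp add: ops h_one one_presented)
    show "bij_betw \<phi> (carrier (generated_subalgebra A ?X)) (carrier P)"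
      unfolding carrier_gen carrier_presented bij_betw_def
      using h_eq_iff by (auto simp: inj_on_def \<phi> image_image)
  qed (auto simp: carrier_gen ops \<phi> cls_add cls_mult simp flip: h_add h_mult)
  moreover have "\<phi> (c \<odot>\<^bsub>generated_subalgebra A ?X\<^esub> a) = c \<odot>\<^bsub>P\<^esub> \<phi> a"
    if "a \<in> carrier (generated_subalgebra A ?X)" for c a
    using that by (auto simp: carrier_gen ops \<phi> cls_smult simp flip: h_smult)
  ultimately show ?thesis
    unfolding algebra_isomorphic_def algebra_iso_def by blast
qed

section \<open>Smash products\<close>

text \<open>The inverse of \<open>act \<alpha>\<close> is \<open>act (- \<alpha>)\<close>; with \<open>G\<close> closed under negation this makes the
  Laurent monomials invertible.\<close>

locale smash_action = A: ring A for A :: "(complex, 'a) module" +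
  fixes G :: "'g::ab_group_add set" and act :: "'g \<Rightarrow> 'a \<Rightarrow> 'a"
  assumes act_closed [simp]: "a \<in> carrier A \<Longrightarrow> act \<alpha> a \<in> carrier A"
    and act_zero [simp]: "act \<alpha> \<zero>\<^bsub>A\<^esub> = \<zero>\<^bsub>A\<^esub>"
    and act_one [simp]: "act \<alpha> \<one>\<^bsub>A\<^esub> = \<one>\<^bsub>A\<^esub>"
    and act_trivial [simp]: "a \<in> carrier A \<Longrightarrow> act 0 a = a"
    and act_act: "a \<in> carrier A \<Longrightarrow> act \<alpha> (act \<beta> a) = act (\<alpha> + \<beta>) a"
    and exponents: "0 \<in> G" "\<alpha> \<in> G \<Longrightarrow> - \<alpha> \<in> G"
begin

abbreviation "S \<equiv> smash A G act"

lemma smash_simps: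
  "one S = smash_tensor A \<one>\<^bsub>A\<^esub> 0" "ring.zero S = (\<lambda>\<gamma>. \<zero>\<^bsub>A\<^esub>)"
  "add S = (\<lambda>f g \<gamma>. f \<gamma> \<oplus>\<^bsub>A\<^esub> g \<gamma>)"
  "module.smult S = (\<lambda>c f \<gamma>. c \<odot>\<^bsub>A\<^esub> f \<gamma>)"
  by (auto simp: smash_def smash_tensor_def)

lemma mem_smash:
  "f \<in> carrier S \<longleftrightarrow> (\<forall>\<alpha>. f \<alpha> \<in> carrier A) \<and> (\<forall>\<alpha>. \<alpha> \<notin> G \<longrightarrow> f \<alpha> = \<zero>\<^bsub>A\<^esub>) \<and>
     finite {\<alpha>. f \<alpha> \<noteq> \<zero>\<^bsub>A\<^esub>}"
  by (simp add: smash_def)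

text \<open>The sum over the support may be enlarged to any convenient finite set of exponents. Supports
  themselves are inconvenient, as they require deciding which elements of \<open>A\<close> vanish.\<close>

lemma smash_mult:
  assumes "f \<in> carrier S" "g \<in> carrier S" "finite B" "{\<alpha>. f \<alpha> \<noteq> \<zero>\<^bsub>A\<^esub>} \<subseteq> B"
  shows "(f \<otimes>\<^bsub>S\<^esub> g) \<gamma> = (\<Oplus>\<^bsub>A\<^esub>\<alpha>\<in>B. f \<alpha> \<otimes>\<^bsub>A\<^esub> act \<alpha> (g (\<gamma> - \<alpha>)))"
proof -
  have "(\<Oplus>\<^bsub>A\<^esub>\<alpha>\<in>{\<alpha>. f \<alpha> \<noteq> \<zero>\<^bsub>A\<^esub>}. f \<alpha> \<otimes>\<^bsub>A\<^esub> act \<alpha> (g (\<gamma> - \<alpha>)))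
      = (\<Oplus>\<^bsub>A\<^esub>\<alpha>\<in>B. f \<alpha> \<otimes>\<^bsub>A\<^esub> act \<alpha> (g (\<gamma> - \<alpha>)))"
    using assms by (intro A.add.finprod_mono_neutral_cong_left) (auto simp: mem_smash)
  then show ?thesis by (simp add: smash_def)
qed

lemma smash_tensor_closed:
  assumes "a \<in> carrier A" "\<alpha> \<in> G"
  shows "smash_tensor A a \<alpha> \<in> carrier S"
proof -
  have "{\<beta>. smash_tensor A a \<alpha> \<beta> \<noteq> \<zero>\<^bsub>A\<^esub>} \<subseteq> {\<alpha>}" by (auto simp: smash_tensor_def)
  then have "finite {\<beta>. smash_tensor A a \<alpha> \<beta> \<noteq> \<zero>\<^bsub>A\<^esub>}" by (rule finite_subset) simp
  then show ?thesis using assms by (auto simp: mem_smash smash_tensor_def)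
qed

lemma tensor_smash_mult:
  assumes "a \<in> carrier A" "\<alpha> \<in> G" "g \<in> carrier S"
  shows "(smash_tensor A a \<alpha> \<otimes>\<^bsub>S\<^esub> g) \<gamma> = a \<otimes>\<^bsub>A\<^esub> act \<alpha> (g (\<gamma> - \<alpha>))"
proof -
  have "(smash_tensor A a \<alpha> \<otimes>\<^bsub>S\<^esub> g) \<gamma> =
      (\<Oplus>\<^bsub>A\<^esub>\<beta>\<in>{\<alpha>}. smash_tensor A a \<alpha> \<beta> \<otimes>\<^bsub>A\<^esub> act \<beta> (g (\<gamma> - \<beta>)))"
    using assms by (intro smash_mult smash_tensor_closed) (auto simp: smash_tensor_def)
  also have "\<dots> = a \<otimes>\<^bsub>A\<^esub> act \<alpha> (g (\<gamma> - \<alpha>))"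
    using assms by (subst A.finsum_insert) (auto simp: smash_tensor_def mem_smash)
  finally show ?thesis .
qed

lemma smash_tensor_mult:
  assumes "a \<in> carrier A" "\<alpha> \<in> G" "b \<in> carrier A" "\<beta> \<in> G"
  shows "smash_tensor A a \<alpha> \<otimes>\<^bsub>S\<^esub> smash_tensor A b \<beta> =
    smash_tensor A (a \<otimes>\<^bsub>A\<^esub> act \<alpha> b) (\<alpha> + \<beta>)"
proof
  fix \<gamma>
  show "(smash_tensor A a \<alpha> \<otimes>\<^bsub>S\<^esub> smash_tensor A b \<beta>) \<gamma> =
      smash_tensor A (a \<otimes>\<^bsub>A\<^esub> act \<alpha> b) (\<alpha> + \<beta>) \<gamma>"
    using assms
    by (subst tensor_smash_mult[OF assms(1,2) smash_tensor_closed[OF assms(3,4)]])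
      (auto simp: smash_tensor_def algebra_simps)
qed

text \<open>An inverse is a chosen object that is characterised by its equations, so it has to be shown
  unique. Multiplication by a Laurent monomial on the left shifts the components and applies an
  invertible map to each, so it can be undone.\<close>

lemma smash_tensor_inv:
  assumes \<alpha>: "\<alpha> \<in> G"
  shows "inv\<^bsub>S\<^esub> (smash_tensor A \<one>\<^bsub>A\<^esub> \<alpha>) = smash_tensor A \<one>\<^bsub>A\<^esub> (- \<alpha>)"
  unfolding m_inv_def
proof (rule the_equality)
  show "smash_tensor A \<one>\<^bsub>A\<^esub> (- \<alpha>) \<in> carrier S \<and>
      smash_tensor A \<one>\<^bsub>A\<^esub> \<alpha> \<otimes>\<^bsub>S\<^esub> smash_tensor A \<one>\<^bsub>A\<^esub> (- \<alpha>) = \<one>\<^bsub>S\<^esub> \<and>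
      smash_tensor A \<one>\<^bsub>A\<^esub> (- \<alpha>) \<otimes>\<^bsub>S\<^esub> smash_tensor A \<one>\<^bsub>A\<^esub> \<alpha> = \<one>\<^bsub>S\<^esub>"
    using \<alpha> exponents by (simp add: smash_tensor_closed smash_tensor_mult smash_simps)
  fix y assume y: "y \<in> carrier S \<and> smash_tensor A \<one>\<^bsub>A\<^esub> \<alpha> \<otimes>\<^bsub>S\<^esub> y = \<one>\<^bsub>S\<^esub> \<and>
      y \<otimes>\<^bsub>S\<^esub> smash_tensor A \<one>\<^bsub>A\<^esub> \<alpha> = \<one>\<^bsub>S\<^esub>"
  then have y_carrier: "\<And>\<delta>. y \<delta> \<in> carrier A" by (simp add: mem_smash)
  show "y = smash_tensor A \<one>\<^bsub>A\<^esub> (- \<alpha>)"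
  proof
    fix \<delta>
    have "act \<alpha> (y \<delta>) = smash_tensor A \<one>\<^bsub>A\<^esub> 0 (\<delta> + \<alpha>)"
      using tensor_smash_mult[OF A.one_closed \<alpha>, of y "\<delta> + \<alpha>"] y y_carrier
      by (simp add: smash_simps)
    then have "act (- \<alpha>) (act \<alpha> (y \<delta>)) = act (- \<alpha>) (smash_tensor A \<one>\<^bsub>A\<^esub> 0 (\<delta> + \<alpha>))"
      by simp
    then have "y \<delta> = act (- \<alpha>) (smash_tensor A \<one>\<^bsub>A\<^esub> 0 (\<delta> + \<alpha>))"
      using y_carrier by (simp add: act_act)
    then show "y \<delta> = smash_tensor A \<one>\<^bsub>A\<^esub> (- \<alpha>) \<delta>"
      by (auto simp: smash_tensor_def eq_neg_iff_add_eq_0)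
  qed
qed

lemma smash_abelian_group: "abelian_group S"
proof (rule abelian_groupI)
  fix f g assume fg: "f \<in> carrier S" "g \<in> carrier S"
  have "{\<alpha>. f \<alpha> \<oplus>\<^bsub>A\<^esub> g \<alpha> \<noteq> \<zero>\<^bsub>A\<^esub>} \<subseteq> {\<alpha>. f \<alpha> \<noteq> \<zero>\<^bsub>A\<^esub>} \<union> {\<alpha>. g \<alpha> \<noteq> \<zero>\<^bsub>A\<^esub>}" by auto
  then have "finite {\<alpha>. f \<alpha> \<oplus>\<^bsub>A\<^esub> g \<alpha> \<noteq> \<zero>\<^bsub>A\<^esub>}"
    using fg by (auto simp: mem_smash elim: finite_subset)
  then show "f \<oplus>\<^bsub>S\<^esub> g \<in> carrier S" using fg by (simp add: mem_smash smash_simps)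
next
  fix f assume f: "f \<in> carrier S"
  have "{\<alpha>. \<ominus>\<^bsub>A\<^esub> f \<alpha> \<noteq> \<zero>\<^bsub>A\<^esub>} \<subseteq> {\<alpha>. f \<alpha> \<noteq> \<zero>\<^bsub>A\<^esub>}" by auto
  then have "finite {\<alpha>. \<ominus>\<^bsub>A\<^esub> f \<alpha> \<noteq> \<zero>\<^bsub>A\<^esub>}"
    using f by (auto simp: mem_smash elim: finite_subset)
  then have "(\<lambda>\<alpha>. \<ominus>\<^bsub>A\<^esub> f \<alpha>) \<in> carrier S" using f by (simp add: mem_smash)
  then show "\<exists>g\<in>carrier S. g \<oplus>\<^bsub>S\<^esub> f = \<zero>\<^bsub>S\<^esub>"
    using f by (intro bexI[of _ "\<lambda>\<alpha>. \<ominus>\<^bsub>A\<^esub> f \<alpha>"]) (auto simp: mem_smash smash_simps A.l_neg)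
qed (auto simp: mem_smash smash_simps A.a_ac)

end

section \<open>Weights and degrees of words\<close>

lemma wt_superset:
  assumes "finite B" "Poly_Mapping.keys \<alpha> \<subseteq> B"
  shows "wt \<alpha> x = (\<Sum>v\<in>B. Poly_Mapping.lookup \<alpha> v * lvar_wt v x)"
  unfolding wt_def using assms by (intro sum.mono_neutral_left) (auto simp: in_keys_iff)

lemma wt_add: "wt (\<alpha> + \<beta>) x = wt \<alpha> x + wt \<beta> x"
proof -
  let ?B = "Poly_Mapping.keys \<alpha> \<union> Poly_Mapping.keys \<beta>"
  have "Poly_Mapping.keys (\<alpha> + \<beta>) \<subseteq> ?B" by (rule Poly_Mapping.keys_add)
  then show ?thesis
    by (subst (1 2 3) wt_superset[of ?B]) (auto simp: lookup_add distrib_right sum.distrib)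
qed

lemma wt_zero [simp]: "wt 0 x = 0"
  by (simp add: wt_def)

lemma wt_single [simp]: "wt (Poly_Mapping.single v c) x = c * lvar_wt v x"
  by (simp add: wt_def)

lemma wt_diff: "wt (\<alpha> - \<beta>) x = wt \<alpha> x - wt \<beta> x"
  using wt_add[of "\<alpha> - \<beta>" \<beta> x] by simp

text \<open>The Laurent monomials see an index only through its row and its column separately; therefore
  the scalar by which one of them commutes past a word depends on the word only through its
  multisets of rows and of columns.\<close>

lemma wt_row_col: "\<exists>r c. \<forall>x. wt \<alpha> x = r (fst x) + c (snd x)"
proof -
  have "\<exists>r c. \<forall>x. lvar_wt v x = r (fst x) + c (snd x)" for v
  proof (cases v)
    case Beta
    then show ?thesis by (intro exI[of _ "\<lambda>_. 1"] exI[of _ "\<lambda>_. 0"]) auto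
  next
    case (Mu k)
    then show ?thesis by (intro exI[of _ "\<lambda>i. of_bool (k < i)"] exI[of _ "\<lambda>_. 0"]) auto
  next
    case (Nu k)
    then show ?thesis by (intro exI[of _ "\<lambda>_. 0"] exI[of _ "\<lambda>j. of_bool (k < j)"]) auto
  qed
  then obtain r c where "\<And>v x. lvar_wt v x = r v (fst x) + c v (snd x)" by metis
  then show ?thesis
    by (intro exI[of _ "\<lambda>i. \<Sum>v\<in>Poly_Mapping.keys \<alpha>. Poly_Mapping.lookup \<alpha> v * r v i"]
        exI[of _ "\<lambda>j. \<Sum>v\<in>Poly_Mapping.keys \<alpha>. Poly_Mapping.lookup \<alpha> v * c v j"])
      (simp add: wt_def distrib_left sum.distrib)
qed

definition content :: "('a \<times> 'b) word \<Rightarrow> 'a multiset \<times> 'b multiset" where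
  "content w = (mset (map fst (letters w)), mset (map snd (letters w)))"

definition word_scale :: "complex \<Rightarrow> (lvar \<Rightarrow>\<^sub>0 int) \<Rightarrow> (nat \<times> nat) word \<Rightarrow> complex" where
  "word_scale q \<alpha> w = (\<Prod>x\<leftarrow>letters w. q powi wt \<alpha> x)"

text \<open>The exponent of \<open>L(\<lambda>\<^sub>\<mu>\<^sub>i)\<^sup>-\<^sup>1 L(\<lambda>\<^sub>\<nu>\<^sub>j)\<close> for \<open>x = (i, j)\<close>.\<close>

definition laurent_shift :: "nat \<Rightarrow> nat \<times> nat \<Rightarrow> (lvar \<Rightarrow>\<^sub>0 int)" where
  "laurent_shift n x =
     (if snd x = n then 0 else Poly_Mapping.single (Nu (snd x)) 1) -
     (if fst x = n then 0 else Poly_Mapping.single (Mu (fst x)) 1)"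

definition laurent_deg :: "nat \<Rightarrow> (nat \<times> nat) word \<Rightarrow> (lvar \<Rightarrow>\<^sub>0 int)" where
  "laurent_deg n w = (\<Sum>x\<leftarrow>letters w. laurent_shift n x)"

text \<open>The scalar that appears when all Laurent factors in a product of elements
  \<open>Z\<^sub>x L(laurent_shift n x)\<close> are moved to the right of the \<open>Z\<^sub>x\<close>.\<close>

primrec list_cocycle :: "complex \<Rightarrow> nat \<Rightarrow> (nat \<times> nat) list \<Rightarrow> complex" where
  "list_cocycle q n [] = 1"
| "list_cocycle q n (x # xs) = word_scale q (laurent_shift n x) (Word xs) * list_cocycle q n xs"

definition cocycle :: "complex \<Rightarrow> nat \<Rightarrow> (nat \<times> nat) word \<Rightarrow> complex" where
  "cocycle q n w = list_cocycle q n (letters w)"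

lemma word_scale_zero [simp]: "word_scale q \<alpha> 0 = 1" "word_scale q 0 w = 1"
proof -
  have "(\<Prod>x\<leftarrow>xs. 1) = (1::complex)" for xs :: "(nat \<times> nat) list" by (induction xs) auto
  then show "word_scale q \<alpha> 0 = 1" "word_scale q 0 w = 1" by (simp_all add: word_scale_def)
qed

lemma word_scale_plus: "word_scale q \<alpha> (u + v) = word_scale q \<alpha> u * word_scale q \<alpha> v"
  by (simp add: word_scale_def)

lemma word_scale_add:
  assumes "q \<noteq> 0"
  shows "word_scale q (\<alpha> + \<beta>) w = word_scale q \<alpha> w * word_scale q \<beta> w"
proof -
  have "(\<Prod>x\<leftarrow>xs. q powi wt (\<alpha> + \<beta>) x) = (\<Prod>x\<leftarrow>xs. q powi wt \<alpha> x) * (\<Prod>x\<leftarrow>xs. q powi wt \<beta> x)" for xs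
    using assms by (induction xs) (auto simp: wt_add power_int_add)
  then show ?thesis by (simp add: word_scale_def)
qed

lemma word_scale_nonzero: "q \<noteq> 0 \<Longrightarrow> word_scale q \<alpha> w \<noteq> 0"
  by (auto simp: word_scale_def prod_list_zero_iff)

lemma word_scale_content:
  assumes q: "q \<noteq> 0" and "content w = content w'"
  shows "word_scale q \<alpha> w = word_scale q \<alpha> w'"
proof -
  obtain r c where rc: "\<And>x. wt \<alpha> x = r (fst x) + c (snd x)" using wt_row_col by metis
  have "(\<Prod>x\<leftarrow>xs. q powi wt \<alpha> x)
      = (\<Prod>i\<in>#mset (map fst xs). q powi r i) * (\<Prod>j\<in>#mset (map snd xs). q powi c j)" for xs
    using q by (induction xs) (auto simp: rc power_int_add)
  then show ?thesis using assms(2) by (simp add: word_scale_def content_def)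
qed

lemma laurent_deg_zero [simp]: "laurent_deg n 0 = 0"
  by (simp add: laurent_deg_def)

lemma laurent_deg_plus: "laurent_deg n (u + v) = laurent_deg n u + laurent_deg n v"
  by (simp add: laurent_deg_def)

lemma laurent_deg_content:
  assumes "content w = content w'"
  shows "laurent_deg n w = laurent_deg n w'"
proof -
  have "(\<Sum>x\<leftarrow>xs. laurent_shift n x)
      = (\<Sum>j\<in>#mset (map snd xs). if j = n then 0 else Poly_Mapping.single (Nu j) 1)
        - (\<Sum>i\<in>#mset (map fst xs). if i = n then 0 else Poly_Mapping.single (Mu i) 1)" for xs
    by (induction xs) (simp_all add: laurent_shift_def algebra_simps)
  then show ?thesis using assms by (simp add: laurent_deg_def content_def)
qed

lemma lexps_closed:
  "0 \<in> lexps n" "\<alpha> \<in> lexps n \<Longrightarrow> - \<alpha> \<in> lexps n"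
  "\<alpha> \<in> lexps n \<Longrightarrow> \<beta> \<in> lexps n \<Longrightarrow> \<alpha> + \<beta> \<in> lexps n"
  "\<alpha> \<in> lexps n \<Longrightarrow> \<beta> \<in> lexps n \<Longrightarrow> \<alpha> - \<beta> \<in> lexps n"
  "v \<in> lvars n \<Longrightarrow> Poly_Mapping.single v c \<in> lexps n"
  using Poly_Mapping.keys_add[of \<alpha> \<beta>] keys_diff[of \<alpha> \<beta>] by (auto simp: lexps_def)

lemma laurent_shift_closed: "x \<in> idx n \<Longrightarrow> laurent_shift n x \<in> lexps n"
  unfolding laurent_shift_def by (intro lexps_closed) (auto simp: idx_def lvars_def intro!: lexps_closed)

lemma laurent_deg_closed:
  assumes "set (letters w) \<subseteq> idx n" shows "laurent_deg n w \<in> lexps n"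
proof -
  have "(\<Sum>x\<leftarrow>xs. laurent_shift n x) \<in> lexps n" if "set xs \<subseteq> idx n" for xs
    using that by (induction xs) (auto intro!: lexps_closed laurent_shift_closed)
  then show ?thesis using assms by (simp add: laurent_deg_def)
qed

lemma cocycle_plus:
  assumes "q \<noteq> 0"
  shows "cocycle q n (u + v) = cocycle q n u * cocycle q n v * word_scale q (laurent_deg n u) v"
proof -
  have "list_cocycle q n (xs @ ys) = list_cocycle q n xs * list_cocycle q n ys *
      word_scale q (\<Sum>x\<leftarrow>xs. laurent_shift n x) (Word ys)" for xs ys
  proof (induction xs)
    case (Cons x xs)
    have "Word (xs @ ys) = Word xs + Word ys" by (simp add: plus_word_def)
    then show ?case
      using Cons by (simp add: word_scale_plus word_scale_add[OF assms])
  qed simp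
  then show ?thesis by (simp add: cocycle_def laurent_deg_def)
qed

lemma cocycle_zero [simp]: "cocycle q n 0 = 1"
  by (simp add: cocycle_def)

lemma cocycle_nonzero: "q \<noteq> 0 \<Longrightarrow> cocycle q n w \<noteq> 0"
proof -
  have "q \<noteq> 0 \<Longrightarrow> list_cocycle q n xs \<noteq> 0" for xs
    by (induction xs) (auto simp: word_scale_nonzero)
  then show "q \<noteq> 0 \<Longrightarrow> cocycle q n w \<noteq> 0" by (simp add: cocycle_def)
qed

lemma cocycle_singleton [simp]: "cocycle q n (Word [x]) = 1"
  by (simp add: cocycle_def word_scale_def)

text \<open>For indices at most \<open>n\<close>, the convention for the Laurent variables of index \<open>n\<close> is consistent
  with the general formula, since no row or column lies beyond \<open>n\<close>.\<close>

lemma cocycle_pair: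
  assumes "x \<in> idx n" "y \<in> idx n"
  shows "cocycle q n (Word [x, y]) = q powi (of_bool (snd x < snd y) - of_bool (fst x < fst y))"
  using assms
  by (cases x; cases y) (auto simp: cocycle_def word_scale_def laurent_shift_def wt_diff idx_def)

lemma lookup_twist_id: "Poly_Mapping.lookup (twist id k f) w = k w * Poly_Mapping.lookup f w"
proof -
  have "Poly_Mapping.lookup (twist id k f) w =
      (\<Sum>v\<in>Poly_Mapping.keys f. if v = w then k w * Poly_Mapping.lookup f w else 0)"
    unfolding twist_def lookup_sum
    by (rule sum.cong) (auto simp: lookup_single when_def word.map_id)
  then show ?thesis by (simp add: in_keys_iff)
qed

lemma free_scale_twist: "free_scale q \<alpha> f = twist id (word_scale q \<alpha>) f"
  by (rule poly_mapping_eqI)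
    (simp add: free_scale_def lookup_mapp lookup_twist_id word_scale_def when_def in_keys_iff)

section \<open>The cocycle exchanges the two sets of relations\<close>

abbreviation (input) pair_mon :: "'x \<Rightarrow> 'x \<Rightarrow> complex \<Rightarrow> 'x free" where
  "pair_mon x y c \<equiv> Poly_Mapping.single (Word [x, y]) c"

lemma free_gen_mult: "free_gen x * free_gen y = pair_mon x y 1"
  by (simp add: free_gen_def mult_single plus_word_def)

lemmas rels_monomial = Let_def free_gen_mult free_const_mult_single mult_1_right

lemma Mq_rels_cases [consumes 1, case_names row column commuting crossing]:
  assumes "r \<in> Mq_rels q n"
  obtains i j k where "i \<in> {1..n}" "j \<in> {1..n}" "k \<in> {1..n}" "j < k"
      "r = pair_mon (i, j) (i, k) 1 - pair_mon (i, k) (i, j) q"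
  | i j k where "i \<in> {1..n}" "j \<in> {1..n}" "k \<in> {1..n}" "i < k"
      "r = pair_mon (i, j) (k, j) 1 - pair_mon (k, j) (i, j) q"
  | i j s t where "i \<in> {1..n}" "j \<in> {1..n}" "s \<in> {1..n}" "t \<in> {1..n}" "i < s" "t < j"
      "r = pair_mon (i, j) (s, t) 1 - pair_mon (s, t) (i, j) 1"
  | i j s t where "i \<in> {1..n}" "j \<in> {1..n}" "s \<in> {1..n}" "t \<in> {1..n}" "i < s" "j < t"
      "r = pair_mon (i, j) (s, t) 1 -
        (pair_mon (s, t) (i, j) 1 + pair_mon (i, t) (s, j) (q - inverse q))"
  using assms unfolding Mq_rels_def rels_monomial
  by (elim UnE CollectE exE conjE)
    ((rule that(1); assumption) | (rule that(2); assumption) | (rule that(3); assumption) |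
     (rule that(4); assumption))+

lemma Mq_rels_intros:
  "i \<in> {1..n} \<Longrightarrow> j \<in> {1..n} \<Longrightarrow> k \<in> {1..n} \<Longrightarrow> j < k \<Longrightarrow>
     pair_mon (i, j) (i, k) 1 - pair_mon (i, k) (i, j) q \<in> Mq_rels q n"
  "i \<in> {1..n} \<Longrightarrow> j \<in> {1..n} \<Longrightarrow> k \<in> {1..n} \<Longrightarrow> i < k \<Longrightarrow>
     pair_mon (i, j) (k, j) 1 - pair_mon (k, j) (i, j) q \<in> Mq_rels q n"
  "i \<in> {1..n} \<Longrightarrow> j \<in> {1..n} \<Longrightarrow> s \<in> {1..n} \<Longrightarrow> t \<in> {1..n} \<Longrightarrow> i < s \<Longrightarrow> t < j \<Longrightarrow>
     pair_mon (i, j) (s, t) 1 - pair_mon (s, t) (i, j) 1 \<in> Mq_rels q n"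
  "i \<in> {1..n} \<Longrightarrow> j \<in> {1..n} \<Longrightarrow> s \<in> {1..n} \<Longrightarrow> t \<in> {1..n} \<Longrightarrow> i < s \<Longrightarrow> j < t \<Longrightarrow>
     pair_mon (i, j) (s, t) 1 -
       (pair_mon (s, t) (i, j) 1 + pair_mon (i, t) (s, j) (q - inverse q)) \<in> Mq_rels q n"
  unfolding Mq_rels_def rels_monomial
  by (rule UnI1, rule UnI1, rule UnI1, blast) (rule UnI1, rule UnI1, rule UnI2, blast,
    rule UnI1, rule UnI2, blast, rule UnI2, blast)

lemma DD_rels_cases [consumes 1, case_names skew crossing row]:
  assumes "r \<in> DD_rels p n"
  obtains i j s t where "i \<in> {1..n}" "j \<in> {1..n}" "s \<in> {1..n}" "t \<in> {1..n}" "s < i" "j \<le> t"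
      "r = pair_mon (i, j) (s, t) 1 - pair_mon (s, t) (i, j) p"
  | i j s t where "i \<in> {1..n}" "j \<in> {1..n}" "s \<in> {1..n}" "t \<in> {1..n}" "s < i" "t < j"
      "r = pair_mon (i, j) (s, t) 1 -
        (pair_mon (s, t) (i, j) 1 + pair_mon (s, j) (i, t) (p - 1))"
  | i j k where "i \<in> {1..n}" "j \<in> {1..n}" "k \<in> {1..n}"
      "r = pair_mon (i, j) (i, k) 1 - pair_mon (i, k) (i, j) 1"
  using assms unfolding DD_rels_def rels_monomial
  by (elim UnE CollectE exE conjE)
    ((rule that(1); assumption) | (rule that(2); assumption) | (rule that(3); assumption))+

lemma DD_rels_intros:
  "i \<in> {1..n} \<Longrightarrow> j \<in> {1..n} \<Longrightarrow> s \<in> {1..n} \<Longrightarrow> t \<in> {1..n} \<Longrightarrow> s < i \<Longrightarrow> j \<le> t \<Longrightarrow>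
     pair_mon (i, j) (s, t) 1 - pair_mon (s, t) (i, j) p \<in> DD_rels p n"
  "i \<in> {1..n} \<Longrightarrow> j \<in> {1..n} \<Longrightarrow> s \<in> {1..n} \<Longrightarrow> t \<in> {1..n} \<Longrightarrow> s < i \<Longrightarrow> t < j \<Longrightarrow>
     pair_mon (i, j) (s, t) 1 -
       (pair_mon (s, t) (i, j) 1 + pair_mon (s, j) (i, t) (p - 1)) \<in> DD_rels p n"
  "i \<in> {1..n} \<Longrightarrow> j \<in> {1..n} \<Longrightarrow> k \<in> {1..n} \<Longrightarrow>
     pair_mon (i, j) (i, k) 1 - pair_mon (i, k) (i, j) 1 \<in> DD_rels p n"
  unfolding DD_rels_def rels_monomial
  by (rule UnI1, rule UnI1, blast) (rule UnI1, rule UnI2, blast, rule UnI2, blast)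

lemma Mq_rels_closed: "Mq_rels q n \<subseteq> carrier (free_algebra (idx n))"
proof
  fix r assume "r \<in> Mq_rels q n"
  then show "r \<in> carrier (free_algebra (idx n))"
    by (cases rule: Mq_rels_cases) (simp_all add: idx_def)
qed

lemma DD_rels_closed: "DD_rels p n \<subseteq> carrier (free_algebra (idx n))"
proof
  fix r assume "r \<in> DD_rels p n"
  then show "r \<in> carrier (free_algebra (idx n))"
    by (cases rule: DD_rels_cases) (simp_all add: idx_def)
qed

lemma content_pair: "content (Word [x, y]) = ({#fst x, fst y#}, {#snd x, snd y#})"
  by (simp add: content_def)

lemma homogeneous_binomial:
  assumes "\<kappa> u = \<kappa> v"
  shows "\<exists>w\<^sub>0. \<forall>w\<in>Poly_Mapping.keys (Poly_Mapping.single u a - Poly_Mapping.single v b). \<kappa> w = \<kappa> w\<^sub>0"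
  using assms by (intro exI[of _ u]) (auto simp: in_keys_iff lookup_minus lookup_single when_def split: if_splits)

lemma homogeneous_trinomial:
  assumes "\<kappa> u = \<kappa> v" "\<kappa> u = \<kappa> u'"
  shows "\<exists>w\<^sub>0. \<forall>w\<in>Poly_Mapping.keys (Poly_Mapping.single u a -
     (Poly_Mapping.single v b + Poly_Mapping.single u' c)). \<kappa> w = \<kappa> w\<^sub>0"
  using assms by (intro exI[of _ u])
    (auto simp: in_keys_iff lookup_minus lookup_add lookup_single when_def split: if_splits)

lemma Mq_rels_homogeneous:
  assumes "r \<in> Mq_rels q n"
  shows "\<exists>w\<^sub>0. \<forall>w\<in>Poly_Mapping.keys r. content w = content w\<^sub>0"
  using assms
proof (cases rule: Mq_rels_cases)
  case crossing
  show ?thesis unfolding crossing(7)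
    by (rule homogeneous_trinomial) (simp_all add: content_pair add_mset_commute)
qed (simp only:, rule homogeneous_binomial, simp add: content_pair add_mset_commute)+

lemma DD_rels_homogeneous:
  assumes "r \<in> DD_rels p n"
  shows "\<exists>w\<^sub>0. \<forall>w\<in>Poly_Mapping.keys r. content w = content w\<^sub>0"
  using assms
proof (cases rule: DD_rels_cases)
  case crossing
  show ?thesis unfolding crossing(7)
    by (rule homogeneous_trinomial) (simp_all add: content_pair add_mset_commute)
qed (simp only:, rule homogeneous_binomial, simp add: content_pair add_mset_commute)+

lemma content_swap: "content (map_word prod.swap w) = prod.swap (content w)"
  by (simp add: content_def comp_def)


lemmas lookup_rels = lookup_minus lookup_add lookup_free_const_mult lookup_single

abbreviation Mq_ideal :: "complex \<Rightarrow> nat \<Rightarrow> (nat \<times> nat) free set" where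
  "Mq_ideal q n \<equiv> Idl\<^bsub>free_algebra (idx n)\<^esub> (Mq_rels q n)"

abbreviation DD_ideal :: "complex \<Rightarrow> nat \<Rightarrow> (nat \<times> nat) free set" where
  "DD_ideal p n \<equiv> Idl\<^bsub>free_algebra (idx n)\<^esub> (DD_rels p n)"

lemma presentation_Mq: "presentation (idx n) (Mq_rels q n)"
  by (rule presentation.intro) (rule Mq_rels_closed)

lemma presentation_DD: "presentation (idx n) (DD_rels p n)"
  by (rule presentation.intro) (rule DD_rels_closed)

lemma (in presentation) smult_rel_mem: "r \<in> R \<Longrightarrow> free_const c * r \<in> I"
  using rels_subset ideal_closed(4) by auto

lemma when_of_bool: "(c when b) = c * of_bool b" for c :: complex
  by (simp add: when_def)

text \<open>The Dipper--Donkin relations, transposed and rescaled by the cocycle, are consequences of the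
  relations of \<open>M\<^sub>q(n)\<close>. A skew relation between generators of one column becomes a row relation,
  any other skew relation a commutation, and the relations within a row become column relations.
  In the crossing relation the correction term comes out in the wrong order, which one commutation
  repairs.\<close>

lemma twist_DD_rels:
  assumes q: "q \<noteq> 0" and "r \<in> DD_rels (q powi (-2)) n"
  shows "twist prod.swap (\<lambda>w. cocycle q n (map_word prod.swap w)) r \<in> Mq_ideal q n"
proof -
  interpret M: presentation "idx n" "Mq_rels q n" by (rule presentation_Mq)
  have p: "q powi (-2) = inverse q ^ 2" using q by (simp add: power_int_minus power_inverse)
  from assms(2) show ?thesis
  proof (cases rule: DD_rels_cases)
    case (skew i j s t)
    then have idx: "(j, i) \<in> idx n" "(t, s) \<in> idx n" by (auto simp: idx_def)
    show ?thesis
    proof (cases "j = t")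
      case True
      have "twist prod.swap (\<lambda>w. cocycle q n (map_word prod.swap w)) r =
          free_const (- inverse q) * (pair_mon (j, s) (j, i) 1 - pair_mon (j, i) (j, s) q)"
        unfolding skew(7) using skew(1-6) True idx q
        by (intro poly_mapping_eqI)
          (simp add: twist_diff lookup_rels cocycle_pair when_of_bool p power2_eq_square field_simps)
      then show ?thesis using skew M.smult_rel_mem Mq_rels_intros(1) by auto
    next
      case False
      have "twist prod.swap (\<lambda>w. cocycle q n (map_word prod.swap w)) r =
          free_const (inverse q) * (pair_mon (j, i) (t, s) 1 - pair_mon (t, s) (j, i) 1)"
        unfolding skew(7) using skew(1-6) False idx q
        by (intro poly_mapping_eqI)
          (simp add: twist_diff lookup_rels cocycle_pair when_of_bool p power2_eq_square power_int_minus field_simps)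
      then show ?thesis using skew False M.smult_rel_mem Mq_rels_intros(3) by auto
    qed
  next
    case (crossing i j s t)
    then have idx: "(j, i) \<in> idx n" "(t, s) \<in> idx n" "(j, s) \<in> idx n" "(t, i) \<in> idx n"
      by (auto simp: idx_def)
    \<comment> \<open>The factor \<open>inverse q - q\<close> is \<open>q * (q powi (-2) - 1)\<close>, where \<open>q\<close> is the value of the
      cocycle on the correction term.\<close>
    have "twist prod.swap (\<lambda>w. cocycle q n (map_word prod.swap w)) r =
        free_const (-1) * (pair_mon (t, s) (j, i) 1 -
           (pair_mon (j, i) (t, s) 1 + pair_mon (t, i) (j, s) (q - inverse q))) +
        free_const (inverse q - q) * (pair_mon (t, i) (j, s) 1 - pair_mon (j, s) (t, i) 1)"
      unfolding crossing(7) using crossing(1-6) idx q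
      by (intro poly_mapping_eqI)
        (simp add: twist_diff twist_add lookup_rels cocycle_pair when_of_bool p power2_eq_square field_simps)
    then show ?thesis
      using crossing M.smult_rel_mem Mq_rels_intros(3,4) by (auto intro!: M.ideal_closed(3))
  next
    case (row i j k)
    then have idx: "(j, i) \<in> idx n" "(k, i) \<in> idx n" by (auto simp: idx_def)
    consider "j < k" | "j = k" | "k < j" by linarith
    then show ?thesis
    proof cases
      case 1
      have "twist prod.swap (\<lambda>w. cocycle q n (map_word prod.swap w)) r =
          free_const (inverse q) * (pair_mon (j, i) (k, i) 1 - pair_mon (k, i) (j, i) q)"
        unfolding row(4) using row(1-3) 1 idx q
        by (intro poly_mapping_eqI)
          (simp add: twist_diff lookup_rels cocycle_pair when_of_bool power_int_minus field_simps)
      then show ?thesis using row 1 M.smult_rel_mem Mq_rels_intros(2) by auto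
    next
      case 2
      then show ?thesis using row M.ideal_closed(2) by simp
    next
      case 3
      have "twist prod.swap (\<lambda>w. cocycle q n (map_word prod.swap w)) r =
          free_const (- inverse q) * (pair_mon (k, i) (j, i) 1 - pair_mon (j, i) (k, i) q)"
        unfolding row(4) using row(1-3) 3 idx q
        by (intro poly_mapping_eqI)
          (simp add: twist_diff lookup_rels cocycle_pair when_of_bool power_int_minus field_simps)
      then show ?thesis using row 3 M.smult_rel_mem Mq_rels_intros(2) by auto
    qed
  qed
qed

text \<open>The same correspondence read backwards: transposing and dividing by the cocycle. The correction
  term of the crossing relation again comes out in the wrong order; here its factors commute only
  up to \<open>p\<close>, and exchanging them produces the coefficient \<open>p - 1\<close>.\<close>

lemma twist_Mq_rels:
  assumes q: "q \<noteq> 0" and "r \<in> Mq_rels q n"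
  shows "twist prod.swap (\<lambda>w. inverse (cocycle q n w)) r \<in> DD_ideal (q powi (-2)) n"
proof -
  interpret D: presentation "idx n" "DD_rels (q powi (-2)) n" by (rule presentation_DD)
  have p: "q powi (-2) = inverse q ^ 2" using q by (simp add: power_int_minus power_inverse)
  from assms(2) show ?thesis
  proof (cases rule: Mq_rels_cases)
    case (row i j k)
    then have idx: "(i, j) \<in> idx n" "(i, k) \<in> idx n" by (auto simp: idx_def)
    have "twist prod.swap (\<lambda>w. inverse (cocycle q n w)) r =
        free_const (- q) * (pair_mon (k, i) (j, i) 1 - pair_mon (j, i) (k, i) (q powi (-2)))"
      unfolding row(5) using row(1-4) idx q
      by (intro poly_mapping_eqI)
        (simp add: twist_diff lookup_rels cocycle_pair when_of_bool p power2_eq_square field_simps)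
    then show ?thesis using row D.smult_rel_mem DD_rels_intros(1) by auto
  next
    case (column i j k)
    then have idx: "(i, j) \<in> idx n" "(k, j) \<in> idx n" by (auto simp: idx_def)
    have "twist prod.swap (\<lambda>w. inverse (cocycle q n w)) r =
        free_const q * (pair_mon (j, i) (j, k) 1 - pair_mon (j, k) (j, i) 1)"
      unfolding column(5) using column(1-4) idx q
      by (intro poly_mapping_eqI)
        (simp add: twist_diff lookup_rels cocycle_pair when_of_bool power_int_minus field_simps)
    then show ?thesis using column D.smult_rel_mem DD_rels_intros(3) by auto
  next
    case (commuting i j s t)
    then have idx: "(i, j) \<in> idx n" "(s, t) \<in> idx n" by (auto simp: idx_def)
    have "twist prod.swap (\<lambda>w. inverse (cocycle q n w)) r =
        free_const q * (pair_mon (j, i) (t, s) 1 - pair_mon (t, s) (j, i) (q powi (-2)))"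
      unfolding commuting(7) using commuting(1-6) idx q
      by (intro poly_mapping_eqI)
        (simp add: twist_diff lookup_rels cocycle_pair when_of_bool p power2_eq_square power_int_minus field_simps)
    then show ?thesis using commuting D.smult_rel_mem DD_rels_intros(1) by auto
  next
    case (crossing i j s t)
    then have idx: "(i, j) \<in> idx n" "(s, t) \<in> idx n" "(i, t) \<in> idx n" "(s, j) \<in> idx n"
      by (auto simp: idx_def)
    \<comment> \<open>The factor \<open>1 - q ^ 2\<close> is \<open>- (q - inverse q) * q\<close>, where \<open>inverse q\<close> is the value of the
      cocycle on the correction term; the skew relation then turns it into \<open>q powi (-2) - 1\<close>.\<close>
    have "twist prod.swap (\<lambda>w. inverse (cocycle q n w)) r =
        free_const (-1) * (pair_mon (t, s) (j, i) 1 -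
           (pair_mon (j, i) (t, s) 1 + pair_mon (j, s) (t, i) (q powi (-2) - 1))) +
        free_const (1 - q ^ 2) *
          (pair_mon (t, i) (j, s) 1 - pair_mon (j, s) (t, i) (q powi (-2)))"
      unfolding crossing(7) using crossing(1-6) idx q
      by (intro poly_mapping_eqI)
        (simp add: twist_diff twist_add lookup_rels cocycle_pair when_of_bool p power2_eq_square power_int_minus field_simps)
    then show ?thesis
      using crossing D.smult_rel_mem DD_rels_intros(1,2) by (auto intro!: D.ideal_closed(3))
  qed
qed

section \<open>The embedding into the semidirect product\<close>

lemma free_scale_mem_Mq_ideal:
  assumes q: "q \<noteq> 0" and f: "f \<in> Mq_ideal q n"
  shows "free_scale q \<alpha> f \<in> Mq_ideal q n"
  unfolding free_scale_twist
proof (rule twist_genideal[where \<kappa> = content and k\<^sub>0 = "\<lambda>_. 1" and V = "idx n" and R = "Mq_rels q n"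
      and m = "\<lambda>u w v. word_scale q \<alpha> (u + w + v)"])
  show "ideal (Mq_ideal q n) (free_algebra (idx n))"
    using presentation_Mq by (rule presentation.ideal_rels)
  show "twist id (\<lambda>_. 1) r \<in> Mq_ideal q n" if "r \<in> Mq_rels q n" for r
    using that presentation.rels_subset[OF presentation_Mq] by (auto simp: twist_id)
  show "word_scale q \<alpha> (u + w + v) = word_scale q \<alpha> (u + w' + v)"
    if "content w = content w'" for u v w w'
    using word_scale_content[OF q that] by (simp add: word_scale_plus)
  show "\<exists>w\<^sub>0. \<forall>w\<in>Poly_Mapping.keys r. content w = content w\<^sub>0" if "r \<in> Mq_rels q n" for r
    using that by (rule Mq_rels_homogeneous)
qed (use f Mq_rels_closed in simp_all)

lemma free_scale_add: "free_scale q \<alpha> (f + g) = free_scale q \<alpha> f + free_scale q \<alpha> g"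
  by (simp add: free_scale_twist twist_add)

lemma free_scale_free_scale:
  "q \<noteq> 0 \<Longrightarrow> free_scale q \<alpha> (free_scale q \<beta> f) = free_scale q (\<alpha> + \<beta>) f"
  by (rule poly_mapping_eqI) (simp add: free_scale_twist lookup_twist_id word_scale_add)

lemma free_scale_zero [simp]: "free_scale q 0 f = f"
  by (rule poly_mapping_eqI) (simp add: free_scale_twist lookup_twist_id)

lemma free_scale_closed:
  "f \<in> carrier (free_algebra V) \<Longrightarrow> free_scale q \<alpha> f \<in> carrier (free_algebra V)"
  unfolding free_scale_twist by (rule twist_closed) auto

lemma free_scale_Mq_ideal:
  assumes "q \<noteq> 0"
  shows "free_scale q \<alpha> ` Mq_ideal q n = Mq_ideal q n"
proof
  show "Mq_ideal q n \<subseteq> free_scale q \<alpha> ` Mq_ideal q n"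
  proof
    fix f assume "f \<in> Mq_ideal q n"
    then have "free_scale q (- \<alpha>) f \<in> Mq_ideal q n"
      using assms by (rule free_scale_mem_Mq_ideal[rotated])
    moreover have "f = free_scale q \<alpha> (free_scale q (- \<alpha>) f)"
      using assms by (simp add: free_scale_free_scale)
    ultimately show "f \<in> free_scale q \<alpha> ` Mq_ideal q n" by (rule rev_image_eqI)
  qed
qed (use assms free_scale_mem_Mq_ideal in auto)

abbreviation Mq_class :: "complex \<Rightarrow> nat \<Rightarrow> (nat \<times> nat) free \<Rightarrow> (nat \<times> nat) free set" where
  "Mq_class q n \<equiv> presented_class (idx n) (Mq_rels q n)"

lemma free_scale_image_class:
  "q \<noteq> 0 \<Longrightarrow> free_scale q \<alpha> ` Mq_class q n f = Mq_class q n (free_scale q \<alpha> f)"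
  by (rule presentation.image_cls[OF presentation_Mq free_scale_add free_scale_Mq_ideal])

lemma smash_action_Mq:
  assumes q: "q \<noteq> 0"
  shows "smash_action (Mq q n) (lexps n) (\<lambda>\<alpha> C. free_scale q \<alpha> ` C)"
proof -
  interpret M: presentation "idx n" "Mq_rels q n" by (rule presentation_Mq)
  interpret ring "Mq q n" unfolding Mq_def by (rule M.P.ring_axioms)
  have carrier: "carrier (Mq q n) = Mq_class q n ` carrier (free_algebra (idx n))"
    by (simp add: Mq_def M.carrier_presented)
  show ?thesis
  proof (intro smash_action.intro smash_action_axioms.intro ring_axioms lexps_closed(1,2))
    fix \<alpha> \<beta> C
    have "free_scale q \<alpha> 0 = 0" "free_scale q \<alpha> 1 = 1"
      by (simp_all add: free_scale_twist flip: single_one)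
    then show "free_scale q \<alpha> ` \<zero>\<^bsub>Mq q n\<^esub> = \<zero>\<^bsub>Mq q n\<^esub>"
      and "free_scale q \<alpha> ` \<one>\<^bsub>Mq q n\<^esub> = \<one>\<^bsub>Mq q n\<^esub>"
      by (simp_all add: Mq_def M.zero_presented M.one_presented free_scale_image_class[OF q])
    assume "C \<in> carrier (Mq q n)"
    then obtain f where f: "f \<in> carrier (free_algebra (idx n))" "C = Mq_class q n f"
      unfolding carrier by auto
    show "free_scale q \<alpha> ` C \<in> carrier (Mq q n)"
      unfolding carrier f(2) free_scale_image_class[OF q] using free_scale_closed[OF f(1)] by simp
    show "free_scale q 0 ` C = C" 
      unfolding f(2) free_scale_image_class[OF q] by simp
    show "free_scale q \<alpha> ` free_scale q \<beta> ` C = free_scale q (\<alpha> + \<beta>) ` C"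
      unfolding f(2) free_scale_image_class[OF q] free_scale_free_scale[OF q] ..
  qed
qed

text \<open>The coefficient of \<open>x\<^sup>\<alpha>\<close> when each generator \<open>D\<^sub>i\<^sub>j\<close> is replaced by the element
  \<open>Z\<^sub>j\<^sub>i L(\<lambda>\<^sub>\<mu>\<^sub>j)\<^sup>-\<^sup>1 L(\<lambda>\<^sub>\<nu>\<^sub>i)\<close> and the Laurent factors are collected on the right, computed
  with words instead of elements of \<open>M\<^sub>q(n)\<close>.\<close>

definition component :: "complex \<Rightarrow> nat \<Rightarrow> (lvar \<Rightarrow>\<^sub>0 int) \<Rightarrow> (nat \<times> nat) free \<Rightarrow> (nat \<times> nat) free" where
  "component q n \<alpha> = twist prod.swap
     (\<lambda>w. of_bool (laurent_deg n (map_word prod.swap w) = \<alpha>) * cocycle q n (map_word prod.swap w))"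

text \<open>Evaluation of noncommutative polynomials at the transposed generators \<open>D_tilde\<close>. The definition
  by components makes sense for all polynomials at once; that it is an algebra homomorphism with
  the right values on generators is shown below.\<close>

definition D_tilde_eval ::
  "complex \<Rightarrow> nat \<Rightarrow> (nat \<times> nat) free \<Rightarrow> (lvar \<Rightarrow>\<^sub>0 int) \<Rightarrow> (nat \<times> nat) free set" where
  "D_tilde_eval q n f \<alpha> = Mq_class q n (component q n \<alpha> f)"

text \<open>The Laurent exponents that can occur in the image of \<open>f\<close>.\<close>

definition degrees :: "nat \<Rightarrow> (nat \<times> nat) free \<Rightarrow> (lvar \<Rightarrow>\<^sub>0 int) set" where
  "degrees n f = (\<lambda>w. laurent_deg n (map_word prod.swap w)) ` Poly_Mapping.keys f"

lemma swap_idx: "prod.swap ` idx n \<subseteq> idx n"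
  by (auto simp: idx_def)

lemma component_closed:
  "f \<in> carrier (free_algebra (idx n)) \<Longrightarrow> component q n \<alpha> f \<in> carrier (free_algebra (idx n))"
  unfolding component_def by (rule twist_closed[OF _ swap_idx])

lemma finite_degrees [simp]: "finite (degrees n f)"
  by (simp add: degrees_def)

lemma degrees_subset:
  assumes "f \<in> carrier (free_algebra (idx n))"
  shows "degrees n f \<subseteq> lexps n"
proof -
  have "laurent_deg n (map_word prod.swap w) \<in> lexps n" if "w \<in> Poly_Mapping.keys f" for w
    using that assms swap_idx by (intro laurent_deg_closed) (fastforce simp: mem_free_algebra)
  then show ?thesis by (auto simp: degrees_def)
qed

lemma component_outside: "\<alpha> \<notin> degrees n f \<Longrightarrow> component q n \<alpha> f = 0"
  unfolding component_def twist_def degrees_def by (intro sum.neutral) auto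

lemma component_mem_Mq_ideal:
  assumes q: "q \<noteq> 0" and f: "f \<in> DD_ideal (q powi (-2)) n"
  shows "component q n \<alpha> f \<in> Mq_ideal q n"
  unfolding component_def
proof (rule twist_genideal[where \<kappa> = content and V = "idx n" and R = "DD_rels (q powi (-2)) n"
      and k\<^sub>0 = "\<lambda>w. cocycle q n (map_word prod.swap w)"
      and m = "\<lambda>u w v. let u = map_word prod.swap u; w = map_word prod.swap w; v = map_word prod.swap v
        in of_bool (laurent_deg n (u + w + v) = \<alpha>) * cocycle q n u * cocycle q n v *
           word_scale q (laurent_deg n u) w * word_scale q (laurent_deg n (u + w)) v"])
  show "ideal (Mq_ideal q n) (free_algebra (idx n))"
    using presentation_Mq by (rule presentation.ideal_rels)
next
  fix u v w w' :: "(nat \<times> nat) word"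
  assume "content w = content w'"
  then have eq: "content (map_word prod.swap w) = content (map_word prod.swap w')"
    by (simp add: content_swap)
  show "(let u = map_word prod.swap u; w = map_word prod.swap w; v = map_word prod.swap v
        in of_bool (laurent_deg n (u + w + v) = \<alpha>) * cocycle q n u * cocycle q n v *
           word_scale q (laurent_deg n u) w * word_scale q (laurent_deg n (u + w)) v) =
      (let u = map_word prod.swap u; w = map_word prod.swap w'; v = map_word prod.swap v
        in of_bool (laurent_deg n (u + w + v) = \<alpha>) * cocycle q n u * cocycle q n v *
           word_scale q (laurent_deg n u) w * word_scale q (laurent_deg n (u + w)) v)"
    by (simp add: Let_def laurent_deg_plus laurent_deg_content[OF eq] word_scale_content[OF q eq])
next
  fix r assume r: "r \<in> DD_rels (q powi (-2)) n"
  show "\<exists>w\<^sub>0. \<forall>w\<in>Poly_Mapping.keys r. content w = content w\<^sub>0"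
    using r by (rule DD_rels_homogeneous)
  show "twist prod.swap (\<lambda>w. cocycle q n (map_word prod.swap w)) r \<in> Mq_ideal q n"
    using q r by (rule twist_DD_rels)
qed (use f swap_idx DD_rels_closed in
  \<open>simp_all add: map_word_plus cocycle_plus[OF q] Let_def mult_ac\<close>)

lemma untwist_mem_DD_ideal:
  assumes q: "q \<noteq> 0" and f: "f \<in> Mq_ideal q n"
  shows "twist prod.swap (\<lambda>w. inverse (cocycle q n w)) f \<in> DD_ideal (q powi (-2)) n"
proof (rule twist_genideal[where \<kappa> = content and V = "idx n" and R = "Mq_rels q n"
      and k\<^sub>0 = "\<lambda>w. inverse (cocycle q n w)"
      and m = "\<lambda>u w v. inverse (cocycle q n u * cocycle q n v *
           word_scale q (laurent_deg n u) w * word_scale q (laurent_deg n (u + w)) v)"])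
  show "ideal (DD_ideal (q powi (-2)) n) (free_algebra (idx n))"
    using presentation_DD by (rule presentation.ideal_rels)
next
  fix u v w w' :: "(nat \<times> nat) word"
  assume eq: "content w = content w'"
  show "inverse (cocycle q n u * cocycle q n v *
           word_scale q (laurent_deg n u) w * word_scale q (laurent_deg n (u + w)) v) =
      inverse (cocycle q n u * cocycle q n v *
           word_scale q (laurent_deg n u) w' * word_scale q (laurent_deg n (u + w')) v)"
    by (simp add: laurent_deg_plus laurent_deg_content[OF eq] word_scale_content[OF q eq])
next
  fix r assume r: "r \<in> Mq_rels q n"
  show "\<exists>w\<^sub>0. \<forall>w\<in>Poly_Mapping.keys r. content w = content w\<^sub>0"
    using r by (rule Mq_rels_homogeneous)
  show "twist prod.swap (\<lambda>w. inverse (cocycle q n w)) r \<in> DD_ideal (q powi (-2)) n"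
    using q r by (rule twist_Mq_rels)
qed (use f swap_idx Mq_rels_closed in \<open>simp_all add: cocycle_plus[OF q] mult_ac\<close>)

text \<open>Words of different Laurent degree end up in different components, but undoing the rescaling
  does not refer to the degree; hence a polynomial can be recovered from its components.\<close>

lemma sum_untwist_components:
  assumes q: "q \<noteq> 0"
  shows "(\<Sum>\<alpha>\<in>degrees n f. twist prod.swap (\<lambda>w. inverse (cocycle q n w)) (component q n \<alpha> f)) = f"
proof (rule poly_mapping_eqI)
  fix w
  let ?d = "laurent_deg n (map_word prod.swap w)"
  have "Poly_Mapping.lookup
      (twist prod.swap (\<lambda>w. inverse (cocycle q n w)) (component q n \<alpha> f)) w =
      (if ?d = \<alpha> then Poly_Mapping.lookup f w else 0)" for \<alpha>
    using cocycle_nonzero[OF q, of n "map_word prod.swap w"]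
    by (simp add: component_def twist_twist lookup_twist_id)
  then show "Poly_Mapping.lookup (\<Sum>\<alpha>\<in>degrees n f.
      twist prod.swap (\<lambda>w. inverse (cocycle q n w)) (component q n \<alpha> f)) w = Poly_Mapping.lookup f w"
    by (simp add: lookup_sum) (auto simp: degrees_def in_keys_iff)
qed

text \<open>The cocycle identity, summed over words: it is the product of the smash product, before
  passing to the quotient.\<close>

lemma component_mult:
  assumes q: "q \<noteq> 0"
  shows "component q n \<gamma> (f * g) =
    (\<Sum>\<alpha>\<in>degrees n f. component q n \<alpha> f * free_scale q \<alpha> (component q n (\<gamma> - \<alpha>) g))"
proof -
  let ?s = "map_word prod.swap" and ?c = "Poly_Mapping.lookup"
  let ?d = "\<lambda>w. laurent_deg n (?s w)"
  let ?t = "\<lambda>u v \<alpha>. Poly_Mapping.single (?s u + ?s v) (of_bool (?d v = \<gamma> - \<alpha>) *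
      (cocycle q n (?s u) * cocycle q n (?s v) * word_scale q \<alpha> (?s v) * (?c f u * ?c g v)))"
  have comp: "component q n \<alpha> f = (\<Sum>u\<in>Poly_Mapping.keys f.
      Poly_Mapping.single (?s u) (of_bool (?d u = \<alpha>) * cocycle q n (?s u) * ?c f u))" for \<alpha>
    by (simp add: component_def twist_def)
  have scale: "free_scale q \<alpha> (component q n \<beta> g) = (\<Sum>v\<in>Poly_Mapping.keys g.
      Poly_Mapping.single (?s v) (word_scale q \<alpha> (?s v) * (of_bool (?d v = \<beta>) * cocycle q n (?s v) * ?c g v)))"
    for \<alpha> \<beta>
    by (simp add: free_scale_twist component_def twist_def[of prod.swap] twist_sum word.map_id)
  have "(\<Sum>\<alpha>\<in>degrees n f. component q n \<alpha> f * free_scale q \<alpha> (component q n (\<gamma> - \<alpha>) g)) =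
      (\<Sum>\<alpha>\<in>degrees n f. \<Sum>u\<in>Poly_Mapping.keys f. \<Sum>v\<in>Poly_Mapping.keys g.
         if ?d u = \<alpha> then ?t u v \<alpha> else 0)"
    unfolding scale comp sum_product
    by (intro sum.cong refl) (simp add: mult_single mult_ac)
  also have "\<dots> = (\<Sum>u\<in>Poly_Mapping.keys f. \<Sum>\<alpha>\<in>degrees n f. \<Sum>v\<in>Poly_Mapping.keys g.
         if ?d u = \<alpha> then ?t u v \<alpha> else 0)"
    by (rule sum.swap)
  also have "\<dots> = (\<Sum>u\<in>Poly_Mapping.keys f. \<Sum>v\<in>Poly_Mapping.keys g. \<Sum>\<alpha>\<in>degrees n f.
         if ?d u = \<alpha> then ?t u v \<alpha> else 0)"
    by (intro sum.cong refl sum.swap)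
  also have "\<dots> = (\<Sum>u\<in>Poly_Mapping.keys f. \<Sum>v\<in>Poly_Mapping.keys g. ?t u v (?d u))"
    by (intro sum.cong refl) (auto simp: degrees_def)
  also have "\<dots> = (\<Sum>u\<in>Poly_Mapping.keys f. \<Sum>v\<in>Poly_Mapping.keys g.
      component q n \<gamma> (Poly_Mapping.single (u + v) (?c f u * ?c g v)))"
    by (intro sum.cong refl arg_cong2[where f = Poly_Mapping.single])
      (auto simp: component_def map_word_plus cocycle_plus[OF q] laurent_deg_plus algebra_simps
        intro!: arg_cong2[where f = Poly_Mapping.single])
  also have "\<dots> = component q n \<gamma> (f * g)"
  proof -
    have "f * g = (\<Sum>u\<in>Poly_Mapping.keys f. \<Sum>v\<in>Poly_Mapping.keys g.
        Poly_Mapping.single (u + v) (?c f u * ?c g v))"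
      using arg_cong2[where f = "(*)", OF sum_monomials[OF finite_keys subset_refl, of f]
          sum_monomials[OF finite_keys subset_refl, of g]]
      by (simp only: sum_product mult_single)
    then show ?thesis by (simp add: component_def twist_sum)
  qed
  finally show ?thesis by simp
qed

lemma L_mu_tensor:
  assumes "q \<noteq> 0"
  shows "L_mu q n k = smash_tensor (Mq q n) \<one>\<^bsub>Mq q n\<^esub>
    (if k = n then 0 else Poly_Mapping.single (Mu k) 1)"
  by (simp add: L_mu_def S_L_def S_alg_def smash_action.smash_simps[OF smash_action_Mq[OF assms]])

lemma L_nu_tensor:
  assumes "q \<noteq> 0"
  shows "L_nu q n k = smash_tensor (Mq q n) \<one>\<^bsub>Mq q n\<^esub>
    (if k = n then 0 else Poly_Mapping.single (Nu k) 1)"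
  by (simp add: L_nu_def S_L_def S_alg_def smash_action.smash_simps[OF smash_action_Mq[OF assms]])

lemma D_tilde_tensor:
  assumes q: "q \<noteq> 0" and ij: "(i, j) \<in> idx n"
  shows "D_tilde q n i j = smash_tensor (Mq q n) (Mq_gen q n i j) (laurent_shift n (i, j))"
proof -
  interpret M: presentation "idx n" "Mq_rels q n" by (rule presentation_Mq)
  interpret S: smash_action "Mq q n" "lexps n" "\<lambda>\<alpha> C. free_scale q \<alpha> ` C"
    by (rule smash_action_Mq[OF q])
  have gen: "Mq_gen q n i j \<in> carrier (Mq q n)"
    using M.cls_closed[of "free_gen (i, j)"] ij
    by (simp add: Mq_gen_def Mq_def presented_gen_def presented_class_def free_gen_def)
  have mu: "(if i = n then 0 else Poly_Mapping.single (Mu i) 1) \<in> lexps n"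
    and nu: "(if j = n then 0 else Poly_Mapping.single (Nu j) 1) \<in> lexps n"
    using ij by (auto simp: idx_def lvars_def intro!: lexps_closed)
  show ?thesis
    unfolding D_tilde_def L_mu_tensor[OF q] L_nu_tensor[OF q] S_Z_def S_alg_def S.smash_tensor_inv[OF mu]
    using S.smash_tensor_mult gen mu nu lexps_closed
    by (simp add: laurent_shift_def)
qed

lemma D_tilde_eval_gen:
  assumes "q \<noteq> 0" "(i, j) \<in> idx n"
  shows "D_tilde_eval q n (free_gen (j, i)) = D_tilde q n i j"
proof
  interpret M: presentation "idx n" "Mq_rels q n" by (rule presentation_Mq)
  fix \<alpha>
  have "laurent_deg n (Word [(i, j)]) = laurent_shift n (i, j)" by (simp add: laurent_deg_def)
  then show "D_tilde_eval q n (free_gen (j, i)) \<alpha> = D_tilde q n i j \<alpha>"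
    using assms
    by (simp add: D_tilde_tensor D_tilde_eval_def component_def free_gen_def smash_tensor_def
        Mq_gen_def presented_gen_def Mq_def M.zero_presented presented_class_def)
qed

lemma D_tilde_eval_closed:
  assumes q: "q \<noteq> 0" and f: "f \<in> carrier (free_algebra (idx n))"
  shows "D_tilde_eval q n f \<in> carrier (S_alg q n)"
    and "{\<alpha>. D_tilde_eval q n f \<alpha> \<noteq> \<zero>\<^bsub>Mq q n\<^esub>} \<subseteq> degrees n f"
proof -
  interpret M: presentation "idx n" "Mq_rels q n" by (rule presentation_Mq)
  have outside: "D_tilde_eval q n f \<alpha> = \<zero>\<^bsub>Mq q n\<^esub>" if "\<alpha> \<notin> degrees n f" for \<alpha>
    using that by (simp add: D_tilde_eval_def component_outside Mq_def M.zero_presented)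
  then show *: "{\<alpha>. D_tilde_eval q n f \<alpha> \<noteq> \<zero>\<^bsub>Mq q n\<^esub>} \<subseteq> degrees n f" by auto
  have "D_tilde_eval q n f \<alpha> \<in> carrier (Mq q n)" for \<alpha>
    using component_closed[OF f] by (simp add: D_tilde_eval_def Mq_def)
  then show "D_tilde_eval q n f \<in> carrier (S_alg q n)"
    unfolding S_alg_def smash_action.mem_smash[OF smash_action_Mq[OF q]]
    using outside degrees_subset[OF f] finite_subset[OF *] by auto
qed

lemma D_tilde_eval_mult:
  assumes q: "q \<noteq> 0"
    and f: "f \<in> carrier (free_algebra (idx n))" and g: "g \<in> carrier (free_algebra (idx n))"
  shows "D_tilde_eval q n (f * g) = D_tilde_eval q n f \<otimes>\<^bsub>S_alg q n\<^esub> D_tilde_eval q n g"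
proof
  fix \<gamma>
  interpret M: presentation "idx n" "Mq_rels q n" by (rule presentation_Mq)
  have closed: "component q n \<alpha> f * free_scale q \<alpha> (component q n (\<gamma> - \<alpha>) g)
      \<in> carrier (free_algebra (idx n))" for \<alpha>
    using component_closed[OF f] component_closed[OF g] free_scale_closed by simp
  have "(D_tilde_eval q n f \<otimes>\<^bsub>S_alg q n\<^esub> D_tilde_eval q n g) \<gamma> =
      (\<Oplus>\<^bsub>Mq q n\<^esub>\<alpha>\<in>degrees n f. D_tilde_eval q n f \<alpha> \<otimes>\<^bsub>Mq q n\<^esub>
         free_scale q \<alpha> ` D_tilde_eval q n g (\<gamma> - \<alpha>))"
    unfolding S_alg_def
    by (intro smash_action.smash_mult[OF smash_action_Mq[OF q]] D_tilde_eval_closed[OF q f]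
        D_tilde_eval_closed(1)[OF q f, unfolded S_alg_def]
        D_tilde_eval_closed(1)[OF q g, unfolded S_alg_def] finite_degrees)
  also have "\<dots> = (\<Oplus>\<^bsub>Mq q n\<^esub>\<alpha>\<in>degrees n f.
      Mq_class q n (component q n \<alpha> f * free_scale q \<alpha> (component q n (\<gamma> - \<alpha>) g)))"
    by (simp only: D_tilde_eval_def free_scale_image_class[OF q] Mq_def
        M.cls_mult[OF component_closed[OF f] free_scale_closed[OF component_closed[OF g]]])
  also have "\<dots> = D_tilde_eval q n (f * g) \<gamma>"
    unfolding Mq_def using closed
    by (simp add: M.cls_sum D_tilde_eval_def component_mult[OF q])
  finally show "D_tilde_eval q n (f * g) \<gamma> =
      (D_tilde_eval q n f \<otimes>\<^bsub>S_alg q n\<^esub> D_tilde_eval q n g) \<gamma>" by simp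
qed

text \<open>If all components of \<open>f\<close> vanish in \<open>M\<^sub>q(n)\<close>, then so do their untwisted versions in the
  Dipper--Donkin algebra, and these sum up to \<open>f\<close>.\<close>

lemma D_tilde_eval_kernel:
  assumes q: "q \<noteq> 0" and f: "f \<in> carrier (free_algebra (idx n))"
  shows "D_tilde_eval q n f = \<zero>\<^bsub>S_alg q n\<^esub> \<longleftrightarrow> f \<in> DD_ideal (q powi (-2)) n"
proof -
  interpret M: presentation "idx n" "Mq_rels q n" by (rule presentation_Mq)
  interpret D: presentation "idx n" "DD_rels (q powi (-2)) n" by (rule presentation_DD)
  have "D_tilde_eval q n f = \<zero>\<^bsub>S_alg q n\<^esub> \<longleftrightarrow> (\<forall>\<alpha>. component q n \<alpha> f \<in> Mq_ideal q n)"
    unfolding S_alg_def smash_action.smash_simps[OF smash_action_Mq[OF q]] fun_eq_iff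
    unfolding D_tilde_eval_def Mq_def
    by (simp only: M.cls_eq_zero_iff[OF component_closed[OF f]])
  also have "\<dots> \<longleftrightarrow> f \<in> DD_ideal (q powi (-2)) n"
  proof
    assume components: "\<forall>\<alpha>. component q n \<alpha> f \<in> Mq_ideal q n"
    have "(\<Sum>\<alpha>\<in>B. twist prod.swap (\<lambda>w. inverse (cocycle q n w)) (component q n \<alpha> f))
        \<in> DD_ideal (q powi (-2)) n" for B
      using components untwist_mem_DD_ideal[OF q]
      by (induction B rule: infinite_finite_induct) (auto intro!: D.ideal_closed(2,3))
    from this[of "degrees n f"] show "f \<in> DD_ideal (q powi (-2)) n"
      by (simp only: sum_untwist_components[OF q])
  qed (use component_mem_Mq_ideal[OF q] in blast)
  finally show ?thesis .
qed

lemma S_alg_simps: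
  assumes "q \<noteq> 0"
  shows "one (S_alg q n) = smash_tensor (Mq q n) \<one>\<^bsub>Mq q n\<^esub> 0"
    "ring.zero (S_alg q n) = (\<lambda>\<gamma>. \<zero>\<^bsub>Mq q n\<^esub>)"
    "add (S_alg q n) = (\<lambda>f g \<gamma>. f \<gamma> \<oplus>\<^bsub>Mq q n\<^esub> g \<gamma>)"
    "module.smult (S_alg q n) = (\<lambda>c f \<gamma>. c \<odot>\<^bsub>Mq q n\<^esub> f \<gamma>)"
  using smash_action.smash_simps[OF smash_action_Mq[OF assms]] by (simp_all only: S_alg_def)

lemma component_add: "component q n \<alpha> (f + g) = component q n \<alpha> f + component q n \<alpha> g"
  by (simp add: component_def twist_add)

lemma component_smult: "component q n \<alpha> (free_const c * f) = free_const c * component q n \<alpha> f"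
  by (simp add: component_def twist_smult)

lemma component_one: "component q n \<alpha> 1 = (if \<alpha> = 0 then 1 else 0)"
  by (simp add: component_def flip: single_one)

lemma D_tilde_eval_add:
  assumes "q \<noteq> 0" "f \<in> carrier (free_algebra (idx n))" "g \<in> carrier (free_algebra (idx n))"
  shows "D_tilde_eval q n (f + g) = D_tilde_eval q n f \<oplus>\<^bsub>S_alg q n\<^esub> D_tilde_eval q n g"
  using assms(2,3)[THEN component_closed] unfolding S_alg_simps[OF assms(1)]
  by (intro ext) (simp add: D_tilde_eval_def Mq_def component_add presentation.cls_add[OF presentation_Mq])

lemma D_tilde_eval_smult:
  assumes "q \<noteq> 0" "f \<in> carrier (free_algebra (idx n))"
  shows "D_tilde_eval q n (free_const c * f) = c \<odot>\<^bsub>S_alg q n\<^esub> D_tilde_eval q n f"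
  using component_closed[OF assms(2)] unfolding S_alg_simps[OF assms(1)]
  by (intro ext) (simp add: D_tilde_eval_def Mq_def component_smult presentation.cls_smult[OF presentation_Mq])

lemma D_tilde_eval_one:
  assumes "q \<noteq> 0"
  shows "D_tilde_eval q n 1 = \<one>\<^bsub>S_alg q n\<^esub>"
  unfolding S_alg_simps[OF assms]
  by (intro ext) (simp add: D_tilde_eval_def Mq_def component_one smash_tensor_def
      presentation.one_presented[OF presentation_Mq] presentation.zero_presented[OF presentation_Mq])

theorem proposition7p1:
  fixes q :: complex and n :: nat
  assumes "q \<noteq> 0" and "q^2 \<noteq> 1"
  shows "algebra_isomorphic (D_tilde_alg q n) (DD (q powi (-2)) n)"
proof -
  note q = assms(1)
  have "algebra_isomorphic
      (generated_subalgebra (S_alg q n) ((\<lambda>x. D_tilde_eval q n (free_gen x)) ` idx n))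
      (presented_algebra (idx n) (DD_rels (q powi (-2)) n))"
    by (rule algebra_isomorphic_presented[OF DD_rels_closed
          smash_action.smash_abelian_group[OF smash_action_Mq[OF q], folded S_alg_def]
          D_tilde_eval_closed(1)[OF q] D_tilde_eval_add[OF q] D_tilde_eval_mult[OF q]
          D_tilde_eval_one[OF q] D_tilde_eval_smult[OF q] D_tilde_eval_kernel[OF q]])
  moreover have "(\<lambda>x. D_tilde_eval q n (free_gen x)) ` idx n
      = {D_tilde q n i j | i j. i \<in> {1..n} \<and> j \<in> {1..n}}"
  proof -
    have "idx n = prod.swap ` idx n" by (auto simp: idx_def image_iff)
    then have "(\<lambda>x. D_tilde_eval q n (free_gen x)) ` idx n
        = (\<lambda>x. D_tilde_eval q n (free_gen (prod.swap x))) ` idx n"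
      by (metis image_image)
    also have "\<dots> = (\<lambda>(i, j). D_tilde q n i j) ` idx n"
      using D_tilde_eval_gen[OF q] by (intro image_cong) auto
    also have "\<dots> = {D_tilde q n i j | i j. i \<in> {1..n} \<and> j \<in> {1..n}}"
      by (auto simp: idx_def) blast
    finally show ?thesis .
  qed
  ultimately show ?thesis by (simp only: D_tilde_alg_def DD_def)
qed

end
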